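(* (1) Let $F,F_0$ be a pair of distributions with $E[X_+]=\int_0^\infty x\,dF(x)<\infty$, $E[|X_0|]=\int_{-\infty}^\infty |x|\,dF_0(x)<\infty$ and $0\le \mu_0<M$, and let $\lambda>0$. Then the corresponding optimal policy $\mu:[0,\infty)\to[0,\infty)$ has the following properties: (i) $\mu(0)=\mu_0=\int_{-\infty}^\infty x\,dF_0(x)$ and $\lim_{t\to+\infty}\mu(t)=M$, where $M=\sup\{x : F(x)<1\}$ (with $M=+\infty$ if the support of $F$ is unbounded from above). (ii) $\mu$ is continuously differentiable. (iii) $\mu'$ is absolutely continuous and satisfies $\mu'(t)>0$ for all $t\ge 0$. In particular $\mu$ is strictly monotone increasing. (iv) $\mu$ is strictly concave. (v) The function $h(t)=-\frac{\mu''(t)}{\mu'(t)}$ (which, by (iii) and (iv), is defined and positive almost everywhere on $[0,\infty)$) is a monotone decreasing function (not necessarily strictly). (vi) The function $h$ satisfies $h(0+)=\lim_{t\to 0+}h(t)\le\lambda$. (2) Conversely, let $\mu:[0,\infty)\to[0,\infty)$ be any function satisfying (ii), (iii), (iv), (v), and let $\lambda$ satisfy $h(0+)\le\lambda$, where $h=-\mu''/\mu'$. Then, defining $M=\lim_{t\to\infty}\mu(t)$, there exists a distribution $F$ with $\int_0^\infty x\,dF(x)<\infty$, such that for any distribution $F_0$ with $\int_{-\infty}^\infty|x|\,dF_0(x)<\infty$ and $\int_{-\infty}^\infty x\,dF_0(x)=\mu(0)$, the function $\mu(t)$ is the optimal policy corresponding to $F$, $F_0$ and $\lambda$.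
   Context: A seller receives independent offers with cumulative distribution function (CDF) $F$ on $\mathbb{R}$, arriving as a Poisson process with rate $\lambda>0$; if no offer is accepted before the deadline, the asset is sold at a random price with CDF $F_0$. $X$ and $X_0$ denote random variables with CDFs $F$ and $F_0$; $y_+=\max(y,0)$; $\mu_0=E[X_0]$; $M=\sup\{x : F(x)<1\}\in(-\infty,+\infty]$. Given $F,F_0,\lambda$ with $E[X_+]<\infty$, $E[|X_0|]<\infty$, $0\le\mu_0<M$, define $\phi(x)=\int_x^\infty[1-F(u)]\,du$ and $\Psi(x)=\int_{\mu_0}^x\frac{du}{\phi(u)}$ for $x\in[\mu_0,M)$. The optimal policy corresponding to $F,F_0,\lambda$ (the threshold function such that accepting an offer $x$ arriving when the remaining time to the deadline is $t$ if and only if $x\ge\mu(t)$ maximizes the expected sale price) is the function $\mu:[0,\infty)\to[\mu_0,M)$, $\mu(t)=\Psi^{-1}(\lambda t)$; equivalently, the solution of $\mu'(t)=\lambda\phi(\mu(t))$, $\mu(0)=\mu_0$.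
   Formalization: Part (2) additionally assumes that μ'(t) tends to 0 as t→∞, which is necessary and automatic for M<∞; without it the converse fails, e.g. for μ(t)=t+1−e^{−t} with λ=1. *)

theory Defs
  imports "HOL-Probability.Probability"
begin

section \<open>Offers, deadline price and the optimal policy\<close>

text \<open>
  A distribution on the real line is a Borel probability measure \<open>F\<close> (locale
  \<open>real_distribution\<close>); the CDF written \<open>F(x)\<close> in the mathematics is \<open>cdf F x\<close>.
\<close>

definition mean :: "real measure \<Rightarrow> real" where
  "mean F0 = (\<integral>x. x \<partial>F0)"

definition upper_end :: "real measure \<Rightarrow> ereal" where
  "upper_end F = Sup {ereal x | x. cdf F x < 1}"

definition sale_problem :: "real measure \<Rightarrow> real measure \<Rightarrow> real \<Rightarrow> bool" where
  "sale_problem F F0 lam \<longleftrightarrow>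
     real_distribution F \<and> real_distribution F0 \<and> 0 < lam \<and>
     integrable F (\<lambda>x. max x 0) \<and> integrable F0 (\<lambda>x. \<bar>x\<bar>) \<and>
     0 \<le> mean F0 \<and> ereal (mean F0) < upper_end F"

definition phi :: "real measure \<Rightarrow> real \<Rightarrow> real" where
  "phi F x = (LBINT u:{x..}. 1 - cdf F u)"

definition Psi :: "real measure \<Rightarrow> real measure \<Rightarrow> real \<Rightarrow> real" where
  "Psi F F0 x = (LBINT u:{mean F0..x}. 1 / phi F u)"

text \<open>Only the values at \<open>t \<ge> 0\<close> are meaningful: there \<open>Psi\<close> attains \<open>lam * t\<close> exactly once.\<close>

definition optimal_policy :: "real measure \<Rightarrow> real measure \<Rightarrow> real \<Rightarrow> real \<Rightarrow> real" where
  "optimal_policy F F0 lam t =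
     the_inv_into {x. mean F0 \<le> x \<and> ereal x < upper_end F} (Psi F F0) (lam * t)"

section \<open>Functions on the half-line\<close>

text \<open>
  A function on \<open>[0, \<infinity>)\<close> is a function \<open>real \<Rightarrow> real\<close> of which only the values on
  \<open>{0..}\<close> are used. Its derivative is taken within \<open>{0..}\<close>: two-sided at
  \<open>t > 0\<close>, from the right at \<open>0\<close>.
\<close>

definition hderiv :: "(real \<Rightarrow> real) \<Rightarrow> real \<Rightarrow> real" where
  "hderiv f t = vector_derivative f (at t within {0..})"

definition C1_halfline :: "(real \<Rightarrow> real) \<Rightarrow> bool" where
  "C1_halfline f \<longleftrightarrow> f differentiable_on {0..} \<and> continuous_on {0..} (hderiv f)"

definition abs_continuous_on :: "real set \<Rightarrow> (real \<Rightarrow> real) \<Rightarrow> bool" where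
  "abs_continuous_on S f \<longleftrightarrow>
     (\<forall>e>0. \<exists>d>0. \<forall>(n::nat) a b.
        (\<forall>i<n. a i \<le> b i \<and> {a i..b i} \<subseteq> S) \<and>
        disjoint_family_on (\<lambda>i. {a i<..<b i}) {..<n} \<and>
        (\<Sum>i<n. b i - a i) < d \<longrightarrow>
        (\<Sum>i<n. \<bar>f (b i) - f (a i)\<bar>) < e)"

definition strictly_concave_on :: "real set \<Rightarrow> (real \<Rightarrow> real) \<Rightarrow> bool" where
  "strictly_concave_on S f \<longleftrightarrow>
     convex S \<and>
     (\<forall>x\<in>S. \<forall>y\<in>S. \<forall>u. x \<noteq> y \<and> 0 < u \<and> u < 1 \<longrightarrow>
        (1 - u) * f x + u * f y < f ((1 - u) * x + u * y))"

text \<open>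
  The second derivative need not exist everywhere, so \<open>h = - f'' / f'\<close> is a partial
  function; \<open>h_dom f\<close> is its domain.
\<close>

definition h_dom :: "(real \<Rightarrow> real) \<Rightarrow> real set" where
  "h_dom f = {t. 0 \<le> t \<and> hderiv f differentiable (at t within {0..})}"

definition h_fun :: "(real \<Rightarrow> real) \<Rightarrow> real \<Rightarrow> real" where
  "h_fun f t = - hderiv (hderiv f) t / hderiv f t"

definition h_at_0_le :: "(real \<Rightarrow> real) \<Rightarrow> real \<Rightarrow> bool" where
  "h_at_0_le f lam \<longleftrightarrow>
     (\<exists>L. (h_fun f \<longlongrightarrow> L) (at 0 within (h_dom f \<inter> {0<..})) \<and> L \<le> lam)"

end

theory Submission
  imports Defs
begin

text \<open>
  Write \<open>f = \<mu>'\<close>. The whole theorem is a translation between two descriptions of the same convex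
  function. On the one side, \<open>\<mu>' = \<lambda> \<phi>(\<mu>)\<close> says that \<open>f = \<lambda> \<phi>\<close> when \<open>f\<close> is read as a function of
  the level \<open>x = \<mu>(t)\<close> in place of the time \<open>t\<close>. On the other side, \<open>\<phi>\<close> is a tail integral of \<open>1 - F\<close>,
  hence convex with slope \<open>-(1 - F(x))\<close>. Dividing \<open>\<mu>'' = \<lambda> \<phi>'(\<mu>) \<mu>'\<close> by \<open>\<mu>'\<close> gives
  \<open>h(t) = \<lambda> (1 - F(\<mu>(t)))\<close>: the ratio \<open>h\<close> is the rate at which offers above the current threshold arrive.
  That \<open>h\<close> decreases and is at most \<open>\<lambda>\<close> is what makes the right-continuous version of \<open>1 - h/\<lambda>\<close>, read
  as a function of the level, a CDF.

  Convexity is used in the form of sandwich inequalities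
  \<open>q(y) (y - x) \<le> Q(y) - Q(x) \<le> q(x) (y - x)\<close> for \<open>x \<le> y\<close>, which hold for \<open>-\<phi>\<close> with \<open>q = 1 - F\<close>,
  for \<open>-\<Psi>\<close> with \<open>q = -1/\<phi>\<close> and for \<open>\<mu>\<close> with \<open>q = f\<close>. They pass from \<open>\<Psi>\<close> to its inverse function,
  they yield the derivative \<open>q\<close> wherever \<open>q\<close> is continuous
  (\<open>sandwich_has_derivative\<close>), and they determine \<open>Q\<close> up to a constant
  (\<open>telescoping_increments_eq\<close>).

  Direct part. \<open>\<Psi>\<close> maps \<open>[\<mu>\<^sub>0, M)\<close> onto \<open>[0, \<infinity>)\<close>, because \<open>\<phi>\<close> is bounded above by a constant and, if
  \<open>M\<close> is finite, by \<open>M - x\<close>. So \<open>\<mu>\<close> is defined, satisfies the sandwich inequalities and hence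
  the differential equation; it inherits all smoothness from \<open>\<phi>\<close>. The second derivative of \<open>\<mu>\<close>
  fails to exist only when \<open>\<mu>(t)\<close> is an atom of \<open>F\<close>, that is, for countably many \<open>t\<close>. Where it exists it
  agrees with the derivative from the right, and this is governed by the right-continuous function \<open>1 - F\<close>;
  this gives the formula for \<open>h\<close> on its whole domain.

  Converse part. The hypotheses speak of \<open>h\<close> only where \<open>f\<close> is differentiable, so everything depends on
  this set being of full measure and on recovering \<open>f\<close> from its derivative there. Both are facts about increasing
  absolutely continuous functions, and both follow from one covering argument, \<open>vitali_comparison\<close>: if
  every point of a set lies in arbitrarily short intervals on which the increment of \<open>G1\<close> is at most \<open>c\<close>
  times that of \<open>G2\<close>, then the Stieltjes measures of the set compare in the same way. Applied to
  one function and the identity it shows that such a function is differentiable almost everywhere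
  (\<open>ac_increasing_AE_differentiable\<close>). Applied to \<open>-f\<close> and \<open>\<mu>\<close>, whose derivatives have the ratio \<open>h\<close>,
  it turns the monotonicity of \<open>h\<close> into sandwich inequalities for \<open>f\<close> as a function of the level
  (\<open>exceed_rate_upper_increment\<close>, \<open>exceed_rate_lower_increment\<close>). Since the tail integral of the CDF
  \<open>1 - h/\<lambda>\<close> satisfies the same inequalities and \<open>f\<close> tends to \<open>0\<close>, it equals \<open>f/\<lambda>\<close>, so
  \<open>\<Psi>(\<mu>(t))\<close> has the constant derivative \<open>\<lambda>\<close>.
\<close>

section \<open>Sandwich inequalities\<close>

text \<open>
  The difference quotient at \<open>t\<close> always lies between \<open>q t\<close> and \<open>q y\<close>. The set \<open>T\<close> may be smaller than
  \<open>S\<close>: at a jump of \<open>q\<close> one still obtains the one-sided derivative on the side where \<open>q\<close> is continuous.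
\<close>

lemma sandwich_has_derivative:
  fixes Q q :: "real \<Rightarrow> real"
  assumes low: "\<And>x y. x \<in> S \<Longrightarrow> y \<in> S \<Longrightarrow> x \<le> y \<Longrightarrow> q y * (y - x) \<le> Q y - Q x"
    and up: "\<And>x y. x \<in> S \<Longrightarrow> y \<in> S \<Longrightarrow> x \<le> y \<Longrightarrow> Q y - Q x \<le> q x * (y - x)"
    and t: "t \<in> T" "T \<subseteq> S" and lim: "(q \<longlongrightarrow> q t) (at t within T)"
  shows "(Q has_real_derivative q t) (at t within T)"
  unfolding has_field_derivative_iff
proof (rule tendsto_sandwich)
  show "((\<lambda>y. min (q y) (q t)) \<longlongrightarrow> q t) (at t within T)"
    using tendsto_min[OF lim tendsto_const[of "q t"]] by simp
  show "((\<lambda>y. max (q y) (q t)) \<longlongrightarrow> q t) (at t within T)"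
    using tendsto_max[OF lim tendsto_const[of "q t"]] by simp
  have *: "min (q y) (q t) \<le> (Q y - Q t) / (y - t) \<and> (Q y - Q t) / (y - t) \<le> max (q y) (q t)"
    if y: "y \<noteq> t" "y \<in> T" for y
  proof (cases "t < y")
    case True
    then have "q y \<le> (Q y - Q t) / (y - t)" "(Q y - Q t) / (y - t) \<le> q t"
      using low[of t y] up[of t y] y t by (auto simp: pos_le_divide_eq pos_divide_le_eq)
    then show ?thesis by auto
  next
    case False
    then have "y < t" using y by simp
    then have "q t \<le> (Q t - Q y) / (t - y)" "(Q t - Q y) / (t - y) \<le> q y"
      using low[of y t] up[of y t] y t by (auto simp: pos_le_divide_eq pos_divide_le_eq)
    moreover have "(Q y - Q t) / (y - t) = (Q t - Q y) / (t - y)"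
      using minus_divide_divide[of "Q t - Q y" "t - y"] by simp
    ultimately show ?thesis by auto
  qed
  show "eventually (\<lambda>y. min (q y) (q t) \<le> (Q y - Q t) / (y - t)) (at t within T)"
    using * by (auto simp: eventually_at_filter intro!: always_eventually)
  show "eventually (\<lambda>y. (Q y - Q t) / (y - t) \<le> max (q y) (q t)) (at t within T)"
    using * by (auto simp: eventually_at_filter intro!: always_eventually)
qed

text \<open>
  The slopes of \<open>Q\<close> to the left of an intermediate point \<open>z\<close> are at least \<open>q z\<close>. Those to the right are strictly
  smaller, because beyond the midpoint of \<open>z\<close> and \<open>y\<close> they are bounded by a smaller value of \<open>q\<close>.
\<close>

lemma sandwich_strictly_concave:
  fixes Q q :: "real \<Rightarrow> real"
  assumes S: "convex S"
    and low: "\<And>x y. x \<in> S \<Longrightarrow> y \<in> S \<Longrightarrow> x \<le> y \<Longrightarrow> q y * (y - x) \<le> Q y - Q x"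
    and up: "\<And>x y. x \<in> S \<Longrightarrow> y \<in> S \<Longrightarrow> x \<le> y \<Longrightarrow> Q y - Q x \<le> q x * (y - x)"
    and q: "\<And>x y. x \<in> S \<Longrightarrow> y \<in> S \<Longrightarrow> x < y \<Longrightarrow> q y < q x"
  shows "strictly_concave_on S Q"
proof -
  have lt: "(1 - u) * Q x + u * Q y < Q ((1 - u) * x + u * y)"
    if xy: "x \<in> S" "y \<in> S" "x < y" and u: "0 < u" "u < 1" for x y u
  proof -
    define z where "z = (1 - u) * x + u * y"
    have zx: "z - x = u * (y - x)" by (simp add: z_def algebra_simps)
    have yz: "y - z = (1 - u) * (y - x)" by (simp add: z_def algebra_simps)
    have "0 < z - x" "0 < y - z" unfolding zx yz using xy u by auto
    then have lz: "x < z" "z < y" by auto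
    have zS: "z \<in> S" using convexD_alt[OF S xy(1,2), of u] u by (simp add: z_def)
    \<comment> \<open>Beyond this midpoint the slopes are at most \<open>q w < q z\<close>.\<close>
    define w where "w = (z + y) / 2"
    have w: "z < w" "w < y" using lz by (auto simp: w_def)
    have wS: "w \<in> S" using convexD_alt[OF S zS xy(2), of "1/2"] by (simp add: w_def field_simps)
    have 1: "q z * (z - x) \<le> Q z - Q x" using low[OF xy(1) zS] lz by simp
    have "Q w - Q z \<le> q z * (w - z)" using up[OF zS wS] w by simp
    moreover have "Q y - Q w \<le> q w * (y - w)" using up[OF wS xy(2)] w by simp
    moreover have "q w * (y - w) < q z * (y - w)" using q[OF zS wS] w by simp
    ultimately have 2: "Q y - Q z < q z * (y - z)"
      by (simp add: algebra_simps)
    have "(1 - u) * (q z * (z - x)) \<le> (1 - u) * (Q z - Q x)"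
      using 1 u by (intro mult_left_mono) auto
    moreover have "u * (Q y - Q z) < u * (q z * (y - z))"
      using 2 u by simp
    moreover have "(1 - u) * (q z * (z - x)) = u * (q z * (y - z))"
      unfolding zx yz by (simp add: algebra_simps)
    ultimately have "u * (Q y - Q z) < (1 - u) * (Q z - Q x)" by linarith
    then show ?thesis unfolding z_def[symmetric] by (simp add: algebra_simps)
  qed
  show ?thesis
    unfolding strictly_concave_on_def
  proof (intro conjI S ballI allI impI, elim conjE)
    fix x y u assume *: "x \<in> S" "y \<in> S" "x \<noteq> y" "(0::real) < u" "u < 1"
    show "(1 - u) * Q x + u * Q y < Q ((1 - u) * x + u * y)"
    proof (cases "x < y")
      case True
      then show ?thesis using lt[of x y u] * by simp
    next
      case False
      then show ?thesis using lt[of y x "1 - u"] * by (simp add: add.commute)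
    qed
  qed
qed

text \<open>
  Cut \<open>[a, b]\<close> into \<open>n\<close> equal pieces: the bounds on the increments telescope to
  \<open>(S a - S b) (b - a) / n\<close>. Two functions sandwiched by the same antitone \<open>S\<close> therefore differ by a
  constant, whatever the discontinuities of \<open>S\<close>.
\<close>

lemma telescoping_increments_eq:
  fixes Q S :: "real \<Rightarrow> real"
  assumes "a \<le> b"
    and inc: "\<And>x y. a \<le> x \<Longrightarrow> x \<le> y \<Longrightarrow> y \<le> b \<Longrightarrow> \<bar>Q y - Q x\<bar> \<le> (S x - S y) * (y - x)"
  shows "Q a = Q b"
proof -
  have bd: "\<bar>Q b - Q a\<bar> \<le> (S a - S b) * (b - a) * inverse (real (Suc n))" for n
  proof -
    define k where "k = (b - a) / real (Suc n)"
    define x where "x i = a + real i * k" for i :: nat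
    have k: "k \<ge> 0" using \<open>a \<le> b\<close> by (simp add: k_def)
    have x0: "x 0 = a" by (simp add: x_def)
    have xn: "x (Suc n) = b" by (simp add: x_def k_def)
    have xs: "x (Suc i) - x i = k" for i by (simp add: x_def algebra_simps)
    have xm: "x i \<le> x j" if "i \<le> j" for i j
      using k that by (auto simp: x_def intro!: mult_right_mono)
    have "Q b - Q a = (\<Sum>i<Suc n. Q (x (Suc i)) - Q (x i))"
      using sum_lessThan_telescope[of "\<lambda>i. Q (x i)" "Suc n"] x0 xn by simp
    also have "\<bar>\<dots>\<bar> \<le> (\<Sum>i<Suc n. \<bar>Q (x (Suc i)) - Q (x i)\<bar>)" by (rule sum_abs)
    also have "\<dots> \<le> (\<Sum>i<Suc n. (S (x i) - S (x (Suc i))) * k)"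
    proof (rule sum_mono)
      fix i assume "i \<in> {..<Suc n}"
      then have "a \<le> x i" "x i \<le> x (Suc i)" "x (Suc i) \<le> b"
        using xm[of 0 i] xm[of i "Suc i"] xm[of "Suc i" "Suc n"] x0 xn by auto
      then show "\<bar>Q (x (Suc i)) - Q (x i)\<bar> \<le> (S (x i) - S (x (Suc i))) * k"
        using inc[of "x i" "x (Suc i)"] by (simp only: xs)
    qed
    also have "\<dots> = (\<Sum>i<Suc n. S (x i) - S (x (Suc i))) * k"
      by (rule sum_distrib_right[symmetric])
    also have "(\<Sum>i<Suc n. S (x i) - S (x (Suc i))) = S a - S b"
      using sum_lessThan_telescope'[of "\<lambda>i. S (x i)" "Suc n"] x0 xn by simp
    finally show ?thesis by (simp add: k_def divide_inverse mult.assoc)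
  qed
  have "(\<lambda>n. (S a - S b) * (b - a) * inverse (real (Suc n))) \<longlonglongrightarrow> (S a - S b) * (b - a) * 0"
    by (intro tendsto_mult tendsto_const LIMSEQ_inverse_real_of_nat)
  then have "\<bar>Q b - Q a\<bar> \<le> (S a - S b) * (b - a) * 0"
    by (rule LIMSEQ_le_const) (use bd in blast)
  then show ?thesis by simp
qed

lemma lipschitz_abs_continuous_on:
  assumes "\<And>x y. x \<in> S \<Longrightarrow> y \<in> S \<Longrightarrow> x \<le> y \<Longrightarrow> \<bar>f y - f x\<bar> \<le> C * (y - x)"
  shows "abs_continuous_on S f"
  unfolding abs_continuous_on_def
proof (intro allI impI)
  fix e :: real assume "e > 0"
  show "\<exists>d>0. \<forall>(n::nat) a b. (\<forall>i<n. a i \<le> b i \<and> {a i..b i} \<subseteq> S) \<and>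
        disjoint_family_on (\<lambda>i. {a i<..<b i}) {..<n} \<and> (\<Sum>i<n. b i - a i) < d \<longrightarrow>
        (\<Sum>i<n. \<bar>f (b i) - f (a i)\<bar>) < e"
  proof (intro exI[of _ "e / (\<bar>C\<bar> + 1)"] conjI allI impI, goal_cases)
    case 1
    then show ?case using \<open>e > 0\<close> by simp
  next
    case (2 n a b)
    then have ab: "a i \<le> b i" "a i \<in> S" "b i \<in> S" if i: "i < n" for i
    proof -
      have *: "a i \<le> b i" "{a i..b i} \<subseteq> S" using 2 i by auto
      show "a i \<le> b i" by (rule *)
      show "a i \<in> S" "b i \<in> S" using *(1) by (auto intro!: subsetD[OF *(2)])
    qed
    have "(\<Sum>i<n. \<bar>f (b i) - f (a i)\<bar>) \<le> (\<Sum>i<n. (\<bar>C\<bar> + 1) * (b i - a i))"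
    proof (rule sum_mono)
      fix i assume "i \<in> {..<n}"
      then have i: "i < n" by simp
      have "\<bar>f (b i) - f (a i)\<bar> \<le> C * (b i - a i)" using assms ab[OF i] by blast
      also have "\<dots> \<le> (\<bar>C\<bar> + 1) * (b i - a i)" using ab[OF i] by (intro mult_right_mono) auto
      finally show "\<bar>f (b i) - f (a i)\<bar> \<le> (\<bar>C\<bar> + 1) * (b i - a i)" .
    qed
    also have "\<dots> = (\<bar>C\<bar> + 1) * (\<Sum>i<n. b i - a i)" by (rule sum_distrib_left[symmetric])
    also have "\<dots> < (\<bar>C\<bar> + 1) * (e / (\<bar>C\<bar> + 1))" using 2 by (intro mult_strict_left_mono) auto
    also have "\<dots> = e" by simp
    finally show ?case .
  qed
qed

lemma abs_continuous_on_extend: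
  assumes "abs_continuous_on {0..} f"
  shows "abs_continuous_on UNIV (\<lambda>t. f (max 0 t))"
  unfolding abs_continuous_on_def
proof (intro allI impI)
  fix e :: real assume "e > 0"
  have "\<exists>d>0. \<forall>(n::nat) a b. (\<forall>i<n. a i \<le> b i \<and> {a i..b i} \<subseteq> {0..}) \<and>
        disjoint_family_on (\<lambda>i. {a i<..<b i}) {..<n} \<and>
        (\<Sum>i<n. b i - a i) < d \<longrightarrow> (\<Sum>i<n. \<bar>f (b i) - f (a i)\<bar>) < e"
    using assms \<open>e > 0\<close> unfolding abs_continuous_on_def by (elim allE[of _ e] impE)
  then obtain d where d: "d > 0" and *: "\<forall>(n::nat) a b. (\<forall>i<n. a i \<le> b i \<and> {a i..b i} \<subseteq> {0..}) \<and>
        disjoint_family_on (\<lambda>i. {a i<..<b i}) {..<n} \<and>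
        (\<Sum>i<n. b i - a i) < d \<longrightarrow> (\<Sum>i<n. \<bar>f (b i) - f (a i)\<bar>) < e"
    by (elim exE conjE)
  show "\<exists>d>0. \<forall>(n::nat) a b. (\<forall>i<n. a i \<le> b i \<and> {a i..b i} \<subseteq> UNIV) \<and>
        disjoint_family_on (\<lambda>i. {a i<..<b i}) {..<n} \<and> (\<Sum>i<n. b i - a i) < d \<longrightarrow>
        (\<Sum>i<n. \<bar>f (max 0 (b i)) - f (max 0 (a i))\<bar>) < e"
  proof (intro exI[of _ d] conjI d allI impI, elim conjE)
    fix n :: nat and a b :: "nat \<Rightarrow> real"
    assume ab: "\<forall>i<n. a i \<le> b i \<and> {a i..b i} \<subseteq> UNIV"
      and dis: "disjoint_family_on (\<lambda>i. {a i<..<b i}) {..<n}" and lt: "(\<Sum>i<n. b i - a i) < d"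
    have 1: "\<forall>i<n. max 0 (a i) \<le> max 0 (b i) \<and> {max 0 (a i)..max 0 (b i)} \<subseteq> {0..}"
      using ab by (auto simp: max_def)
    have sub: "{max 0 (a i)<..<max 0 (b i)} \<subseteq> {a i<..<b i}" for i by auto
    have 2: "disjoint_family_on (\<lambda>i. {max 0 (a i)<..<max 0 (b i)}) {..<n}"
      unfolding disjoint_family_on_def
    proof (intro ballI impI)
      fix i j assume "i \<in> {..<n}" "j \<in> {..<n}" "i \<noteq> j"
      then have "{a i<..<b i} \<inter> {a j<..<b j} = {}" using dis by (auto simp: disjoint_family_on_def)
      then show "{max 0 (a i)<..<max 0 (b i)} \<inter> {max 0 (a j)<..<max 0 (b j)} = {}"
        using sub[of i] sub[of j] by blast
    qed
    have "(\<Sum>i<n. max 0 (b i) - max 0 (a i)) \<le> (\<Sum>i<n. b i - a i)"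
      using ab by (intro sum_mono) (auto simp: max_def)
    then have 3: "(\<Sum>i<n. max 0 (b i) - max 0 (a i)) < d" using lt by simp
    show "(\<Sum>i<n. \<bar>f (max 0 (b i)) - f (max 0 (a i))\<bar>) < e"
      using *[THEN spec, THEN spec, THEN spec, of n "\<lambda>i. max 0 (a i)" "\<lambda>i. max 0 (b i)"] 1 2 3
      by blast
  qed
qed

lemma set_integral_bounds:
  fixes g :: "real \<Rightarrow> real"
  assumes int: "set_integrable lborel A g" and A: "A \<in> sets borel" "emeasure lborel A = ennreal (y - x)"
    and "x \<le> y" and g: "\<And>u. u \<in> A \<Longrightarrow> l \<le> g u" "\<And>u. u \<in> A \<Longrightarrow> g u \<le> r"
  shows "l * (y - x) \<le> (LBINT u:A. g u)" "(LBINT u:A. g u) \<le> r * (y - x)"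
proof -
  have c: "set_integrable lborel A (\<lambda>_. c)" "(LBINT u:A. c) = c * (y - x)" for c :: real
  proof -
    show "set_integrable lborel A (\<lambda>_. c)"
      using A by (simp add: set_integrable_def)
    show "(LBINT u:A. c) = c * (y - x)"
      using set_integral_const[of A lborel c] A \<open>x \<le> y\<close> by (simp add: measure_def)
  qed
  show "l * (y - x) \<le> (LBINT u:A. g u)"
    using set_integral_mono[OF c(1)[of l] int g(1)] c(2)[of l] by simp
  show "(LBINT u:A. g u) \<le> r * (y - x)"
    using set_integral_mono[OF int c(1)[of r] g(2)] c(2)[of r] by simp
qed

section \<open>Comparison of increasing absolutely continuous functions\<close>

text \<open>
  These are the distribution functions of the atomless measures used below to compare increments:
  \<open>abs_continuous_on\<close> makes the Stieltjes measure uniformly absolutely continuous with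
  respect to Lebesgue measure.
\<close>

definition ac_increasing :: "(real \<Rightarrow> real) \<Rightarrow> bool" where
  "ac_increasing G \<longleftrightarrow> mono G \<and> abs_continuous_on UNIV G"

lemma abs_continuous_on_imp_dist:
  assumes "abs_continuous_on S f" "e > 0"
  shows "\<exists>d>0. \<forall>a b. a \<le> b \<longrightarrow> {a..b} \<subseteq> S \<longrightarrow> b - a < d \<longrightarrow> \<bar>f b - f a\<bar> < e"
proof -
  have "\<exists>d>0. \<forall>(n::nat) a b. (\<forall>i<n. a i \<le> b i \<and> {a i..b i} \<subseteq> S) \<and>
        disjoint_family_on (\<lambda>i. {a i<..<b i}) {..<n} \<and>
        (\<Sum>i<n. b i - a i) < d \<longrightarrow> (\<Sum>i<n. \<bar>f (b i) - f (a i)\<bar>) < e"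
    using assms unfolding abs_continuous_on_def by (elim allE[of _ e] impE)
  then obtain d where d: "d > 0" and *: "\<forall>(n::nat) a b. (\<forall>i<n. a i \<le> b i \<and> {a i..b i} \<subseteq> S) \<and>
        disjoint_family_on (\<lambda>i. {a i<..<b i}) {..<n} \<and>
        (\<Sum>i<n. b i - a i) < d \<longrightarrow> (\<Sum>i<n. \<bar>f (b i) - f (a i)\<bar>) < e"
    by (elim exE conjE)
  show ?thesis
  proof (intro exI[of _ d] conjI d allI impI)
    fix a b :: real assume "a \<le> b" "{a..b} \<subseteq> S" "b - a < d"
    then show "\<bar>f b - f a\<bar> < e"
      using *[THEN spec, THEN spec, THEN spec, of 1 "\<lambda>_. a" "\<lambda>_. b"] by (simp add: disjoint_family_on_def)
  qed
qed

lemma ac_increasing_continuous: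
  assumes "ac_increasing G"
  shows "continuous_on UNIV G"
proof -
  have "isCont G x" for x
  proof (subst continuous_at_eps_delta, intro allI impI)
    fix e :: real assume "e > 0"
    have "abs_continuous_on UNIV G" using assms by (simp add: ac_increasing_def)
    from abs_continuous_on_imp_dist[OF this \<open>e > 0\<close>]
    obtain d where d: "d > 0" "\<And>a b. a \<le> b \<Longrightarrow> b - a < d \<Longrightarrow> \<bar>G b - G a\<bar> < e"
      by auto
    show "\<exists>d>0. \<forall>x'. dist x' x < d \<longrightarrow> dist (G x') (G x) < e"
    proof (intro exI[of _ d] conjI d allI impI)
      fix y assume "dist y x < d"
      then show "dist (G y) (G x) < e"
        using d(2)[of x y] d(2)[of y x] by (cases "x \<le> y") (auto simp: dist_real_def abs_minus_commute)
    qed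
  qed
  then show ?thesis by (simp add: continuous_on_eq_continuous_at)
qed

lemma emeasure_interval_measure_ac:
  assumes "ac_increasing G" "a \<le> b"
  shows "emeasure (interval_measure G) {a..b} = ennreal (G b - G a)"
    and "emeasure (interval_measure G) {a<..<b} = ennreal (G b - G a)"
proof -
  have Icc: "emeasure (interval_measure G) {a..b} = ennreal (G b - G a)" if "a \<le> b" for a b
  proof (rule emeasure_interval_measure_Icc[OF that _ ac_increasing_continuous[OF assms(1)]])
    show "G x \<le> G y" if "x \<le> y" for x y
      using assms(1) that by (auto simp: ac_increasing_def mono_def)
  qed
  show "emeasure (interval_measure G) {a..b} = ennreal (G b - G a)"
    by (rule Icc[OF assms(2)])
  have null: "{x} \<in> null_sets (interval_measure G)" for x
    using Icc[of x x] by (intro null_setsI) simp_all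
  have eq: "{a..b} = {a<..<b} \<union> {a, b}" using assms(2) by auto
  have "{a, b} \<in> null_sets (interval_measure G)"
    using null_sets.Un[OF null[of a] null[of b]] by (metis insert_is_Un)
  then have "emeasure (interval_measure G) ({a<..<b} \<union> {a, b}) = emeasure (interval_measure G) {a<..<b}"
    by (intro emeasure_Un_null_set) auto
  then show "emeasure (interval_measure G) {a<..<b} = ennreal (G b - G a)"
    unfolding eq[symmetric] Icc[OF assms(2)] by (rule sym)
qed

text \<open>
  Absolute continuity of functions speaks of finite families of non-overlapping intervals, so
  this is the case of sets for which it can be applied directly.
\<close>

lemma ac_increasing_measure_finite_union:
  assumes G: "ac_increasing G" and "finite \<F>"
    and ivl: "\<And>K. K \<in> \<F> \<Longrightarrow> \<exists>c e. K = {c..e} \<and> c \<le> e"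
    and disj: "pairwise (\<lambda>A B. interior A \<inter> interior B = {}) \<F>"
    and small: "\<And>n a b. (\<forall>i<(n::nat). a i \<le> b i) \<Longrightarrow>
        disjoint_family_on (\<lambda>i. {a i<..<b i}) {..<n} \<Longrightarrow>
        (\<Sum>i<n. b i - a i) < d \<Longrightarrow> (\<Sum>i<n. \<bar>G (b i) - G (a i)\<bar>) < e"
    and sub: "\<Union>\<F> \<subseteq> U" and U: "open U" "emeasure lborel U < ennreal d"
  shows "emeasure (interval_measure G) (\<Union>\<F>) \<le> ennreal e"
proof -
  obtain lo hi where lh0: "\<And>K. K \<in> \<F> \<Longrightarrow> K = {lo K..hi K} \<and> lo K \<le> hi K"
    using ivl by metis
  have lhE: "K = {lo K..hi K}" and lh: "lo K \<le> hi K" if "K \<in> \<F>" for K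
    using lh0[OF that] by blast+
  obtain k where k: "bij_betw k {..<card \<F>} \<F>"
    using ex_bij_betw_nat_finite[OF \<open>finite \<F>\<close>] by (auto simp: lessThan_atLeast0)
  have kF: "k i \<in> \<F>" if "i < card \<F>" for i using k that by (auto simp: bij_betw_def)
  have int: "interior K = {lo K<..<hi K}" if "K \<in> \<F>" for K
    by (subst lhE[OF that]) (rule interior_atLeastAtMost_real)
  have dF: "disjoint_family_on (\<lambda>K. {lo K<..<hi K}) \<F>"
    using disj int unfolding disjoint_family_on_def pairwise_def by auto
  have "ennreal (\<Sum>K\<in>\<F>. hi K - lo K) = (\<Sum>K\<in>\<F>. ennreal (hi K - lo K))"
    using lh by (subst sum_ennreal) auto
  also have "\<dots> = (\<Sum>K\<in>\<F>. emeasure lborel {lo K<..<hi K})"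
    using lh by (intro sum.cong) auto
  also have "\<dots> = emeasure lborel (\<Union>K\<in>\<F>. {lo K<..<hi K})"
    using dF \<open>finite \<F>\<close> by (intro sum_emeasure) auto
  also have "\<dots> \<le> emeasure lborel U"
  proof (rule emeasure_mono)
    have "{lo K<..<hi K} \<subseteq> K" if "K \<in> \<F>" for K
      using int[OF that] interior_subset[of K] by simp
    then show "(\<Union>K\<in>\<F>. {lo K<..<hi K}) \<subseteq> U" using sub by blast
  qed (use U in simp)
  also note U(2)
  finally have lt: "(\<Sum>K\<in>\<F>. hi K - lo K) < d"
    using lh by (subst (asm) ennreal_less_iff) (auto intro!: sum_nonneg)
  have "(\<Sum>i<card \<F>. \<bar>G (hi (k i)) - G (lo (k i))\<bar>) < e"
  proof (rule small)
    show "\<forall>i<card \<F>. lo (k i) \<le> hi (k i)" using lh kF by auto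
    show "disjoint_family_on (\<lambda>i. {lo (k i)<..<hi (k i)}) {..<card \<F>}"
      unfolding disjoint_family_on_def
    proof (intro ballI impI)
      fix i j assume ij: "i \<in> {..<card \<F>}" "j \<in> {..<card \<F>}" "i \<noteq> j"
      then have "k i \<noteq> k j" using k by (auto simp: bij_betw_def inj_on_def)
      then show "{lo (k i)<..<hi (k i)} \<inter> {lo (k j)<..<hi (k j)} = {}"
        using dF kF ij unfolding disjoint_family_on_def by (metis lessThan_iff)
    qed
    show "(\<Sum>i<card \<F>. hi (k i) - lo (k i)) < d"
      using lt sum.reindex_bij_betw[OF k, of "\<lambda>K. hi K - lo K"] by simp
  qed
  then have le: "(\<Sum>K\<in>\<F>. \<bar>G (hi K) - G (lo K)\<bar>) < e"
    using sum.reindex_bij_betw[OF k, of "\<lambda>K. \<bar>G (hi K) - G (lo K)\<bar>"] by simp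
  have bor: "K \<in> sets borel" if "K \<in> \<F>" for K
    using lhE[OF that] by (metis borel_closed closed_atLeastAtMost)
  have "emeasure (interval_measure G) (\<Union>\<F>) \<le> (\<Sum>K\<in>\<F>. emeasure (interval_measure G) K)"
    using emeasure_subadditive_finite[of \<F> "\<lambda>K. K" "interval_measure G"] bor \<open>finite \<F>\<close> by auto
  also have "\<dots> = (\<Sum>K\<in>\<F>. ennreal \<bar>G (hi K) - G (lo K)\<bar>)"
  proof (rule sum.cong)
    fix K assume "K \<in> \<F>"
    then have "G (lo K) \<le> G (hi K)" "lo K \<le> hi K"
      using lh[of K] G by (auto simp: ac_increasing_def mono_def)
    then have "emeasure (interval_measure G) {lo K..hi K} = ennreal \<bar>G (hi K) - G (lo K)\<bar>"
      using emeasure_interval_measure_ac(1)[OF G, of "lo K" "hi K"] by simp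
    then show "emeasure (interval_measure G) K = ennreal \<bar>G (hi K) - G (lo K)\<bar>"
      unfolding lhE[OF \<open>K \<in> \<F>\<close>, symmetric] .
  qed simp
  also have "\<dots> \<le> ennreal e"
    using le by (subst sum_ennreal) (auto intro: ennreal_leI)
  finally show ?thesis .
qed

lemma emeasure_split:
  assumes "B \<in> sets M" "U \<in> sets M" "B \<subseteq> U"
  shows "emeasure M U = emeasure M B + emeasure M (U - B)"
  using plus_emeasure[of B M "U - B"] assms by (simp add: Un_absorb1)

text \<open>
  A bounded part of an open set is exhausted by finite unions of non-overlapping dyadic intervals
  inside the set, which handles open sets; outer regularity of Lebesgue measure then handles Borel sets.
\<close>

lemma ac_increasing_measure_small:
  assumes G: "ac_increasing G" and "e > 0"
  obtains d where "d > 0"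
    "\<And>B. B \<in> sets borel \<Longrightarrow> emeasure lborel B < ennreal d \<Longrightarrow>
         emeasure (interval_measure G) B \<le> ennreal e"
proof -
  let ?\<nu> = "interval_measure G"
  have "abs_continuous_on UNIV G" using G by (simp add: ac_increasing_def)
  then have "\<exists>d>0. \<forall>(n::nat) a b. (\<forall>i<n. a i \<le> b i \<and> {a i..b i} \<subseteq> UNIV) \<and>
        disjoint_family_on (\<lambda>i. {a i<..<b i}) {..<n} \<and>
        (\<Sum>i<n. b i - a i) < d \<longrightarrow> (\<Sum>i<n. \<bar>G (b i) - G (a i)\<bar>) < e"
    using \<open>e > 0\<close> unfolding abs_continuous_on_def by (elim allE[of _ e] impE)
  then obtain d where d: "d > 0" and small0: "\<forall>(n::nat) a b. (\<forall>i<n. a i \<le> b i \<and> {a i..b i} \<subseteq> UNIV) \<and>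
        disjoint_family_on (\<lambda>i. {a i<..<b i}) {..<n} \<and>
        (\<Sum>i<n. b i - a i) < d \<longrightarrow> (\<Sum>i<n. \<bar>G (b i) - G (a i)\<bar>) < e"
    by (elim exE conjE)
  have small: "(\<Sum>i<n. \<bar>G (b i) - G (a i)\<bar>) < e"
    if "\<forall>i<(n::nat). a i \<le> b i" "disjoint_family_on (\<lambda>i. {a i<..<b i}) {..<n}"
      "(\<Sum>i<n. b i - a i) < d" for n a b
    using small0[THEN spec, THEN spec, THEN spec, THEN mp, of n a b] that by simp
  have bounded_part: "emeasure ?\<nu> (U \<inter> {-real (Suc n)..real (Suc n)}) \<le> ennreal e"
    if U: "open U" "emeasure lborel U < ennreal d" for U n
  proof -
    define S where "S = U \<inter> {-real (Suc n)..real (Suc n)}"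
    have g1: "gauge (\<lambda>x. if x \<in> U then U else UNIV)"
      using U by (auto simp: gauge_def)
    have g2: "S \<subseteq> cbox (-real (Suc n)) (real (Suc n))" by (auto simp: S_def)
    have g3: "box (-real (Suc n)) (real (Suc n)) \<noteq> {}" by simp
    obtain \<D> where D: "countable \<D>"
        "\<And>K. K \<in> \<D> \<Longrightarrow> interior K \<noteq> {} \<and> (\<exists>c d. K = cbox c d)"
        "pairwise (\<lambda>A B. interior A \<inter> interior B = {}) \<D>"
        "\<And>K. K \<in> \<D> \<Longrightarrow> \<exists>x \<in> S \<inter> K. K \<subseteq> (if x \<in> U then U else UNIV)"
        "S \<subseteq> \<Union>\<D>"
      by (rule covering_lemma[OF g2 g3 g1]) blast
    have DU: "\<Union>\<D> \<subseteq> U" using D(4) by (force simp: S_def)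
    have ivl: "\<exists>c e. K = {c..e} \<and> c \<le> e" if K: "K \<in> \<D>" for K
      using D(2)[OF K] by (metis atLeastatMost_empty_iff2 cbox_interval interior_empty)
    have fin: "emeasure ?\<nu> (\<Union>\<F>) \<le> ennreal e" if F: "finite \<F>" "\<F> \<subseteq> \<D>" for \<F>
      by (rule ac_increasing_measure_finite_union[OF G F(1) _ _ small _ U])
         (use F ivl DU pairwise_subset[OF D(3)] in auto)
    have bor: "K \<in> sets borel" if "K \<in> \<D>" for K
      using ivl[OF that] by (metis borel_closed closed_atLeastAtMost)
    show ?thesis
    proof (cases "\<D> = {}")
      case True
      then show ?thesis using D(5) by (simp add: S_def)
    next
      case False
      define k where "k = from_nat_into \<D>"
      have k: "range k = \<D>" unfolding k_def using False D(1) by (rule range_from_nat_into)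
      have "emeasure ?\<nu> S \<le> emeasure ?\<nu> (\<Union>n. \<Union>i\<le>n. k i)"
      proof (rule emeasure_mono)
        show "S \<subseteq> (\<Union>n. \<Union>i\<le>n. k i)" using D(5) k by blast
        have "k i \<in> sets borel" for i using bor k by blast
        then show "(\<Union>n. \<Union>i\<le>n. k i) \<in> sets ?\<nu>" by auto
      qed
      also have "\<dots> = (SUP n. emeasure ?\<nu> (\<Union>i\<le>n. k i))"
      proof (rule SUP_emeasure_incseq[symmetric])
        have "k i \<in> sets borel" for i using bor k by blast
        then show "range (\<lambda>n. \<Union>i\<le>n. k i) \<subseteq> sets ?\<nu>" by auto
        show "incseq (\<lambda>n. \<Union>i\<le>n. k i)" by (fastforce simp: incseq_def)
      qed
      also have "\<dots> \<le> ennreal e"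
      proof (rule SUP_least)
        fix n show "emeasure ?\<nu> (\<Union>i\<le>n. k i) \<le> ennreal e"
          using fin[of "k ` {..n}"] k by auto
      qed
      finally show ?thesis by (simp add: S_def)
    qed
  qed
  have opn: "emeasure ?\<nu> U \<le> ennreal e" if U: "open U" "emeasure lborel U < ennreal d" for U
  proof -
    have "emeasure ?\<nu> U = emeasure ?\<nu> (\<Union>n. U \<inter> {-real (Suc n)..real (Suc n)})"
    proof (rule arg_cong[where f = "emeasure ?\<nu>"], safe)
      fix x assume "x \<in> U"
      obtain n where "\<bar>x\<bar> \<le> real n" using real_arch_simple by blast
      then show "x \<in> (\<Union>n. U \<inter> {-real (Suc n)..real (Suc n)})"
        using \<open>x \<in> U\<close> by (intro UN_I[of n]) auto
    qed
    also have "\<dots> = (SUP n. emeasure ?\<nu> (U \<inter> {-real (Suc n)..real (Suc n)}))"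
      using U by (intro SUP_emeasure_incseq[symmetric]) (auto simp: incseq_def)
    also have "\<dots> \<le> ennreal e" by (intro SUP_least bounded_part U)
    finally show ?thesis .
  qed
  show ?thesis
  proof (rule that[OF d])
    fix B :: "real set" assume B: "B \<in> sets borel" "emeasure lborel B < ennreal d"
    obtain r where r: "emeasure lborel B = ennreal r" "0 \<le> r" "r < d"
      using B(2) by (cases "emeasure lborel B") (auto simp: ennreal_less_iff)
    obtain U where U: "open U" "B \<subseteq> U" "emeasure lborel (U - B) < ennreal (d - r)"
      using outer_regular_lborel[OF B(1), of "d - r"] r by auto
    have "emeasure lborel U = emeasure lborel B + emeasure lborel (U - B)"
      using U B by (intro emeasure_split) auto
    also have "\<dots> < ennreal r + ennreal (d - r)"
      unfolding r(1) by (subst ennreal_add_left_cancel_less) (use U in auto)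
    also have "\<dots> = ennreal d" using r by (simp flip: ennreal_plus)
    finally have "emeasure ?\<nu> U \<le> ennreal e" by (rule opn[OF U(1)])
    moreover have "emeasure ?\<nu> B \<le> emeasure ?\<nu> U" using U B by (intro emeasure_mono) auto
    ultimately show "emeasure ?\<nu> B \<le> ennreal e" by simp
  qed
qed

lemma ac_increasing_null_sets:
  assumes "ac_increasing G" "N \<in> null_sets lborel"
  shows "N \<in> null_sets (interval_measure G)"
proof -
  have N: "N \<in> sets borel" "emeasure lborel N = 0" using assms(2) by (auto simp: null_sets_def)
  have small: "emeasure (interval_measure G) N \<le> ennreal e" if e: "e > 0" for e
  proof (rule ac_increasing_measure_small[OF assms(1) e])
    fix d :: real
    assume "d > 0" and "\<And>B. B \<in> sets borel \<Longrightarrow> emeasure lborel B < ennreal d \<Longrightarrow>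
         emeasure (interval_measure G) B \<le> ennreal e"
    then show "emeasure (interval_measure G) N \<le> ennreal e" using N by simp
  qed
  have "emeasure (interval_measure G) N \<le> 0"
  proof (rule ennreal_le_epsilon)
    fix e :: real assume "e > 0"
    then show "emeasure (interval_measure G) N \<le> 0 + ennreal e" using small by simp
  qed
  then show ?thesis using N by auto
qed

text \<open>
  Enclose \<open>E\<close> in an open \<open>U\<close> so close to \<open>E\<close> that the second measure hardly grows. By Vitali's covering
  theorem, disjoint intervals inside \<open>U\<close> with the assumed inequality cover \<open>E\<close> up to a Lebesgue null set,
  which is null for the first measure too; summing the inequality over them gives the claim.
\<close>

lemma vitali_comparison:
  assumes G1: "ac_increasing G1" and G2: "ac_increasing G2"
    and E: "E \<in> sets borel" and "c \<ge> 0"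
    and fine: "\<And>x d. x \<in> E \<Longrightarrow> d > 0 \<Longrightarrow>
      \<exists>u v. u < x \<and> x < v \<and> v - u < d \<and> G1 v - G1 u \<le> c * (G2 v - G2 u)"
  shows "emeasure (interval_measure G1) E \<le> ennreal c * emeasure (interval_measure G2) E"
proof -
  let ?\<alpha> = "interval_measure G1" and ?\<beta> = "interval_measure G2"
  have main: "emeasure ?\<alpha> E \<le> ennreal c * (emeasure ?\<beta> E + ennreal e)" if e: "e > 0" for e
  proof -
    obtain d where d: "d > 0" "\<And>B. B \<in> sets borel \<Longrightarrow> emeasure lborel B < ennreal d \<Longrightarrow>
         emeasure ?\<beta> B \<le> ennreal e"
      using ac_increasing_measure_small[OF G2 e] by blast
    obtain U where U: "open U" "E \<subseteq> U" "emeasure lborel (U - E) < ennreal d"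
      using outer_regular_lborel[OF E d(1)] by blast
    have "emeasure ?\<beta> U = emeasure ?\<beta> E + emeasure ?\<beta> (U - E)"
      using U E by (intro emeasure_split) auto
    also have "\<dots> \<le> emeasure ?\<beta> E + ennreal e"
      using d(2)[of "U - E"] U E by (intro add_left_mono) auto
    finally have \<beta>U: "emeasure ?\<beta> U \<le> emeasure ?\<beta> E + ennreal e" .
    \<comment> \<open>The Vitali cover, indexed by pairs of endpoints.\<close>
    define K where "K = {(u, v). u < v \<and> {u<..<v} \<subseteq> U \<and> G1 v - G1 u \<le> c * (G2 v - G2 u)}"
    let ?I = "\<lambda>p::real\<times>real. {fst p<..<snd p}"
    have ball: "ball ((fst p + snd p) / 2) ((snd p - fst p) / 2) = ?I p" for p :: "real \<times> real"
      by (auto simp: ball_def dist_real_def abs_if field_simps split: if_splits)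
    have cov: "\<exists>i. i \<in> K \<and> x \<in> ball ((fst i + snd i) / 2) ((snd i - fst i) / 2) \<and> (snd i - fst i) / 2 < d"
      if x: "x \<in> E" "d > 0" for x d
    proof -
      obtain r where r: "r > 0" "ball x r \<subseteq> U" using U x by (meson open_contains_ball subsetD)
      obtain u v where uv: "u < x" "x < v" "v - u < min r d" "G1 v - G1 u \<le> c * (G2 v - G2 u)"
        using fine[of x "min r d"] x r by auto
      have "{u<..<v} \<subseteq> ball x r" using uv by (auto simp: dist_real_def)
      then have "(u, v) \<in> K" using uv r by (auto simp: K_def)
      then show ?thesis using uv x(2) by (intro exI[of _ "(u, v)"]) (simp only: ball, auto)
    qed
    obtain C where C: "countable C" "C \<subseteq> K"
        "pairwise (\<lambda>i j. disjnt (?I i) (?I j)) C" "negligible (E - (\<Union>i\<in>C. ?I i))"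
      by (rule Vitali_covering_theorem_balls[of E K "\<lambda>i. (fst i + snd i) / 2" "\<lambda>i. (snd i - fst i) / 2", OF cov,
              unfolded ball])
    define W where "W = (\<Union>i\<in>C. ?I i)"
    have W: "W \<in> sets borel" unfolding W_def by (intro borel_open open_UN ballI open_greaterThanLessThan)
    have CI: "disjoint_family_on ?I C"
      using C(3) by (auto simp: disjoint_family_on_def pairwise_def disjnt_def)
    have "E - W \<in> null_sets lborel"
    proof (subst null_sets_completion_iff[symmetric])
      show "E - W \<in> sets lborel" using E W by simp
      show "E - W \<in> null_sets lebesgue"
        using C(4) unfolding W_def[symmetric] negligible_iff_null_sets .
    qed
    then have "E - W \<in> null_sets ?\<alpha>" by (rule ac_increasing_null_sets[OF G1])
    then have "emeasure ?\<alpha> (W \<union> (E - W)) = emeasure ?\<alpha> W"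
      using W by (intro emeasure_Un_null_set) auto
    then have "emeasure ?\<alpha> E \<le> emeasure ?\<alpha> W"
      using E W by (metis Un_Diff_cancel emeasure_mono sets.Un sets_interval_measure sup_ge2)
    also have "\<dots> = (\<integral>\<^sup>+i. emeasure ?\<alpha> (?I i) \<partial>count_space C)"
      unfolding W_def using C CI by (intro emeasure_UN_countable) auto
    also have "\<dots> \<le> (\<integral>\<^sup>+i. ennreal c * emeasure ?\<beta> (?I i) \<partial>count_space C)"
    proof (rule nn_integral_mono)
      fix i assume "i \<in> space (count_space C)"
      then have "i \<in> K" using C by auto
      then have *: "fst i < snd i" "G1 (snd i) - G1 (fst i) \<le> c * (G2 (snd i) - G2 (fst i))"
        by (auto simp: K_def)
      then show "emeasure ?\<alpha> (?I i) \<le> ennreal c * emeasure ?\<beta> (?I i)"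
        using emeasure_interval_measure_ac(2)[OF G1, of "fst i" "snd i"]
          emeasure_interval_measure_ac(2)[OF G2, of "fst i" "snd i"] \<open>c \<ge> 0\<close>
        by (simp add: ennreal_leI ennreal_mult'[symmetric])
    qed
    also have "\<dots> = ennreal c * (\<integral>\<^sup>+i. emeasure ?\<beta> (?I i) \<partial>count_space C)"
      by (rule nn_integral_cmult) auto
    also have "(\<integral>\<^sup>+i. emeasure ?\<beta> (?I i) \<partial>count_space C) = emeasure ?\<beta> W"
      unfolding W_def using C CI by (intro emeasure_UN_countable[symmetric]) auto
    also have "ennreal c * emeasure ?\<beta> W \<le> ennreal c * emeasure ?\<beta> U"
    proof (intro mult_left_mono emeasure_mono)
      have "?I p \<subseteq> U" if "p \<in> C" for p using C(2) that by (cases p) (auto simp: K_def)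
      then show "W \<subseteq> U" unfolding W_def by blast
    qed (use U in auto)
    also have "\<dots> \<le> ennreal c * (emeasure ?\<beta> E + ennreal e)"
      using \<beta>U by (rule mult_left_mono) simp
    finally show ?thesis .
  qed
  show ?thesis
  proof (rule ennreal_le_epsilon)
    fix e :: real assume e: "e > 0"
    have "emeasure ?\<alpha> E \<le> ennreal c * (emeasure ?\<beta> E + ennreal (e / (c + 1)))"
      using e \<open>c \<ge> 0\<close> by (intro main) auto
    also have "\<dots> = ennreal c * emeasure ?\<beta> E + ennreal (c * (e / (c + 1)))"
      by (simp only: distrib_left ennreal_mult'[OF \<open>c \<ge> 0\<close>])
    also have "\<dots> \<le> ennreal c * emeasure ?\<beta> E + ennreal e"
      using e \<open>c \<ge> 0\<close> by (intro add_left_mono ennreal_leI) (auto simp: field_simps)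
    finally show "emeasure ?\<alpha> E \<le> ennreal c * emeasure ?\<beta> E + ennreal e" .
  qed
qed

lemma ac_increasing_identity: "ac_increasing (\<lambda>x. x)"
  unfolding ac_increasing_def abs_continuous_on_def
proof (intro conjI allI impI)
  show "mono (\<lambda>x::real. x)" by (rule monoI)
  fix e :: real assume "e > 0"
  show "\<exists>d>0. \<forall>(n::nat) a b. (\<forall>i<n. a i \<le> b i \<and> {a i..b i} \<subseteq> UNIV) \<and>
        disjoint_family_on (\<lambda>i. {a i<..<b i}) {..<n} \<and> (\<Sum>i<n. b i - a i) < d \<longrightarrow>
        (\<Sum>i<n. \<bar>b i - a i\<bar>) < e"
  proof (intro exI[of _ e] conjI \<open>e > 0\<close> allI impI, elim conjE)
    fix n :: nat and a b :: "nat \<Rightarrow> real"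
    assume *: "\<forall>i<n. a i \<le> b i \<and> {a i..b i} \<subseteq> UNIV" "(\<Sum>i<n. b i - a i) < e"
    have "(\<Sum>i<n. \<bar>b i - a i\<bar>) = (\<Sum>i<n. b i - a i)"
      using * by (intro sum.cong) auto
    then show "(\<Sum>i<n. \<bar>b i - a i\<bar>) < e" using * by simp
  qed
qed

text \<open>
  A substitute for the fundamental theorem of calculus: an inequality between derivatives that
  holds almost everywhere passes to the increments. At a point where \<open>D1 < c D2\<close> the function \<open>c G2 - G1\<close> has
  positive derivative, hence a positive increment over every short interval around the point.
\<close>

lemma ac_increasing_compare:
  assumes G1: "ac_increasing G1" and G2: "ac_increasing G2" and "a \<le> b" "c \<ge> 0"
    and ae: "AE x in lborel. a < x \<and> x < b \<longrightarrow> (\<exists>D1 D2. (G1 has_real_derivative D1) (at x) \<and>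
       (G2 has_real_derivative D2) (at x) \<and> D1 < c * D2)"
  shows "G1 b - G1 a \<le> c * (G2 b - G2 a)"
proof -
  define P where "P x \<longleftrightarrow> (\<exists>D1 D2. (G1 has_real_derivative D1) (at x) \<and>
       (G2 has_real_derivative D2) (at x) \<and> D1 < c * D2)" for x
  obtain N where N: "{x \<in> space lborel. \<not> (a < x \<and> x < b \<longrightarrow> P x)} \<subseteq> N"
      "emeasure lborel N = 0" "N \<in> sets lborel"
    by (rule AE_E[OF ae[folded P_def]])
  have Nn: "N \<in> null_sets lborel" using N by auto
  define E where "E = {a<..<b} - N"
  have E: "E \<in> sets borel" using N by (auto simp: E_def)
  have le: "emeasure (interval_measure G1) E \<le> ennreal c * emeasure (interval_measure G2) E"
  proof (rule vitali_comparison[OF G1 G2 E \<open>c \<ge> 0\<close>])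
    fix x d :: real assume x: "x \<in> E" and d: "d > 0"
    have "P x" using x N(1) by (auto simp: E_def)
    then obtain D1 D2 where D: "(G1 has_real_derivative D1) (at x)" "(G2 has_real_derivative D2) (at x)" "D1 < c * D2"
      unfolding P_def by blast
    have k: "((\<lambda>y. c * G2 y - G1 y) has_real_derivative c * D2 - D1) (at x)"
      by (rule DERIV_diff[OF DERIV_cmult[OF D(2)] D(1)])
    have pos: "0 < c * D2 - D1" using D(3) by simp
    obtain d1 where d1: "d1 > 0" "\<forall>h>0. h < d1 \<longrightarrow> c * G2 x - G1 x < c * G2 (x + h) - G1 (x + h)"
      using DERIV_pos_inc_right[OF k pos] by auto
    obtain d2 where d2: "d2 > 0" "\<forall>h>0. h < d2 \<longrightarrow> c * G2 (x - h) - G1 (x - h) < c * G2 x - G1 x"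
      using DERIV_pos_inc_left[OF k pos] by auto
    \<comment> \<open>The third keeps the length \<open>2 h\<close> of the interval around \<open>x\<close> below \<open>d\<close>.\<close>
    define h where "h = min (min d1 d2) d / 3"
    have h: "h > 0" "h < d1" "h < d2" "2 * h < d" using d1(1) d2(1) d by (auto simp: h_def)
    have "G1 (x + h) - G1 (x - h) \<le> c * (G2 (x + h) - G2 (x - h))"
    proof -
      have "c * G2 x - G1 x < c * G2 (x + h) - G1 (x + h)" using d1(2) h by blast
      moreover have "c * G2 (x - h) - G1 (x - h) < c * G2 x - G1 x" using d2(2) h by blast
      ultimately show ?thesis by (simp add: right_diff_distrib)
    qed
    then show "\<exists>u v. u < x \<and> x < v \<and> v - u < d \<and> G1 v - G1 u \<le> c * (G2 v - G2 u)"
      using h by (intro exI[of _ "x - h"] exI[of _ "x + h"]) auto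
  qed
  have m: "emeasure (interval_measure G) E = ennreal (G b - G a)" if G: "ac_increasing G" for G
  proof -
    have "emeasure (interval_measure G) E = emeasure (interval_measure G) {a<..<b}"
      unfolding E_def by (rule emeasure_Diff_null_set[OF ac_increasing_null_sets[OF G Nn]]) simp
    then show ?thesis using emeasure_interval_measure_ac(2)[OF G \<open>a \<le> b\<close>] by simp
  qed
  have "G2 a \<le> G2 b" using G2 \<open>a \<le> b\<close> by (auto simp: ac_increasing_def mono_def)
  then show ?thesis
    using le \<open>c \<ge> 0\<close> unfolding m[OF G1] m[OF G2] ennreal_mult'[OF \<open>c \<ge> 0\<close>, symmetric]
    by (subst (asm) ennreal_le_iff) auto
qed

text \<open>
  The set is a countable intersection of unions of open intervals. This is why derivates are
  taken over open intervals around the point and not over intervals starting at it.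
\<close>

lemma fine_intervals_borel:
  fixes R :: "real \<Rightarrow> real \<Rightarrow> bool"
  shows "{x. \<forall>d>0. \<exists>u v. u < x \<and> x < v \<and> v - u < d \<and> R u v} \<in> sets borel"
proof -
  have "{x. \<forall>d>0. \<exists>u v. u < x \<and> x < v \<and> v - u < d \<and> R u v} =
    (\<Inter>n::nat. \<Union>p\<in>{p. snd p - fst p < inverse (real (Suc n)) \<and> R (fst p) (snd p)}. {fst p<..<snd p})"
    (is "?A = ?B")
  proof (intro equalityI subsetI)
    fix x assume x: "x \<in> ?A"
    show "x \<in> ?B"
    proof
      fix n :: nat
      obtain u v where "u < x \<and> x < v \<and> v - u < inverse (real (Suc n)) \<and> R u v"
        using x[unfolded mem_Collect_eq, THEN spec, THEN mp, of "inverse (real (Suc n))"] by auto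
      then show "x \<in> (\<Union>p\<in>{p. snd p - fst p < inverse (real (Suc n)) \<and> R (fst p) (snd p)}. {fst p<..<snd p})"
        by (intro UN_I[of "(u, v)"]) auto
    qed
  next
    fix x assume x: "x \<in> ?B"
    show "x \<in> ?A"
    proof (intro CollectI allI impI)
      fix d :: real assume "d > 0"
      then obtain n where n: "inverse (real (Suc n)) < d" using reals_Archimedean by blast
      have "x \<in> (\<Union>p\<in>{p. snd p - fst p < inverse (real (Suc n)) \<and> R (fst p) (snd p)}. {fst p<..<snd p})"
        using x by blast
      then obtain p where "snd p - fst p < inverse (real (Suc n))" "R (fst p) (snd p)" "fst p < x" "x < snd p"
        by auto
      then show "\<exists>u v. u < x \<and> x < v \<and> v - u < d \<and> R u v"
        using n by (intro exI[of _ "fst p"] exI[of _ "snd p"]) auto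
    qed
  qed
  moreover have "?B \<in> sets borel"
  proof (rule sets.countable_INT'')
    show "(\<Union>p\<in>{p. snd p - fst p < inverse (real (Suc n)) \<and> R (fst p) (snd p)}. {fst p<..<snd p}) \<in> sets borel" for n
      by (intro borel_open open_UN ballI open_greaterThanLessThan)
  qed auto
  ultimately show ?thesis by (simp only:)
qed

text \<open>
  Bounds over open intervals around \<open>x\<close> extend by continuity to intervals with endpoint \<open>x\<close>, as
  difference quotients require.
\<close>

lemma slope_bound_closure:
  fixes G :: "real \<Rightarrow> real"
  assumes G: "continuous_on UNIV G"
    and bd: "\<And>u v. u < x \<Longrightarrow> x < v \<Longrightarrow> v - u < d \<Longrightarrow> G v - G u \<le> c * (v - u)"
    and uv: "u \<le> x" "x \<le> v" "v - u < d"
  shows "G v - G u \<le> c * (v - u)"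
proof (rule tendsto_le[of "at_right (0::real)" "\<lambda>h. c * ((v + h) - (u - h))" _ "\<lambda>h. G (v + h) - G (u - h)"])
  have cont: "isCont G y" for y using G by (simp add: continuous_on_eq_continuous_at)
  have 1: "((\<lambda>h. v + h) \<longlongrightarrow> v) (at_right 0)" "((\<lambda>h. u - h) \<longlongrightarrow> u) (at_right 0)"
    by (auto intro!: tendsto_eq_intros)
  show "((\<lambda>h. G (v + h) - G (u - h)) \<longlongrightarrow> G v - G u) (at_right 0)"
    by (intro tendsto_diff isCont_tendsto_compose[OF cont] 1)
  show "((\<lambda>h. c * ((v + h) - (u - h))) \<longlongrightarrow> c * (v - u)) (at_right 0)"
    by (intro tendsto_mult tendsto_diff 1 tendsto_const)
  have "eventually (\<lambda>h. h \<in> {0<..<(d - (v - u)) / 2}) (at_right (0::real))"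
    using uv by (intro eventually_at_right_real) auto
  then show "eventually (\<lambda>h. G (v + h) - G (u - h) \<le> c * ((v + h) - (u - h))) (at_right 0)"
  proof eventually_elim
    case (elim h)
    then show ?case using uv by (intro bd) auto
  qed
qed simp

lemma null_sets_bounded_parts:
  assumes "B \<in> sets borel" "\<And>n::nat. emeasure lborel (B \<inter> {-real n..real n}) = 0"
  shows "B \<in> null_sets lborel"
proof -
  have "B = (\<Union>n::nat. B \<inter> {-real n..real n})"
  proof safe
    fix x assume "x \<in> B"
    obtain n where "\<bar>x\<bar> \<le> real n" using real_arch_simple by blast
    then show "x \<in> (\<Union>n::nat. B \<inter> {-real n..real n})"
      using \<open>x \<in> B\<close> by (intro UN_I[of n]) auto
  qed
  moreover have "(\<Union>n::nat. B \<inter> {-real n..real n}) \<in> null_sets lborel"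
    using assms by (intro null_sets_UN null_setsI) auto
  ultimately show ?thesis by simp
qed

text \<open>
  Lebesgue's theorem. \<open>L p\<close> and \<open>U q\<close> are the points where some sequence of shrinking intervals has
  slopes at most \<open>p\<close>, or at least \<open>q\<close>. For \<open>p < q\<close>, comparing with Lebesgue measure in both directions shows
  that the measure \<open>r\<close> of a bounded part of \<open>L p \<inter> U q\<close> satisfies \<open>r \<le> (p/q) r\<close>, so it is \<open>0\<close>; likewise the
  points lying in every \<open>U q\<close> form a null set. Outside these countably many null sets all the slopes around a
  point have a common finite limit.
\<close>

theorem ac_increasing_AE_differentiable:
  assumes G: "ac_increasing G"
  shows "AE x in lborel. G differentiable (at x)"
proof -
  let ?\<nu> = "interval_measure G"
  define L where "L p = {x. \<forall>d>0. \<exists>u v. u < x \<and> x < v \<and> v - u < d \<and> G v - G u \<le> p * (v - u)}" for p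
  define U where "U q = {x. \<forall>d>0. \<exists>u v. u < x \<and> x < v \<and> v - u < d \<and> q * (v - u) \<le> G v - G u}" for q
  have LB: "L p \<in> sets borel" for p unfolding L_def by (rule fine_intervals_borel)
  have UB: "U q \<in> sets borel" for q unfolding U_def by (rule fine_intervals_borel)
  have Gm: "G x \<le> G y" if "x \<le> y" for x y using G that by (auto simp: ac_increasing_def mono_def)
  have lower: "emeasure ?\<nu> E \<le> ennreal p * emeasure lborel E"
    if "E \<in> sets borel" "E \<subseteq> L p" "p \<ge> 0" for E p
    unfolding lborel_eq_real
    by (rule vitali_comparison[OF G ac_increasing_identity that(1,3)]) (use that(2) in \<open>auto simp: L_def\<close>)
  have upper: "emeasure lborel E \<le> ennreal (1 / q) * emeasure ?\<nu> E"
    if E: "E \<in> sets borel" "E \<subseteq> U q" "q > 0" for E q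
    unfolding lborel_eq_real
  proof (rule vitali_comparison[OF ac_increasing_identity G E(1)])
    show "0 \<le> 1 / q" using E by simp
    fix x d :: real assume "x \<in> E" "d > 0"
    then obtain u v where "u < x \<and> x < v \<and> v - u < d \<and> q * (v - u) \<le> G v - G u"
      using E(2) unfolding U_def by blast
    then show "\<exists>u v. u < x \<and> x < v \<and> v - u < d \<and> v - u \<le> 1 / q * (G v - G u)"
      using E(3) by (intro exI[of _ u] exI[of _ v]) (auto simp: field_simps)
  qed
  have fin: "emeasure lborel (B \<inter> {-real n..real n}) < \<infinity>" if "B \<in> sets borel" for B and n :: nat
    using emeasure_mono[of "B \<inter> {-real n..real n}" "{-real n..real n}" lborel]
    by (simp add: le_less_trans)
  have null1: "L p \<inter> U q \<in> null_sets lborel" if pq: "0 \<le> p" "p < q" for p q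
  proof -
    have z: "emeasure lborel (L p \<inter> U q \<inter> {-real n..real n}) = 0" for n :: nat
    proof -
      let ?E = "L p \<inter> U q \<inter> {-real n..real n}"
      have EB: "?E \<in> sets borel" using LB UB by simp
      obtain r where r: "emeasure lborel ?E = ennreal r" "r \<ge> 0"
        using fin[of "L p \<inter> U q" n] LB UB by (cases "emeasure lborel ?E") auto
      have "emeasure lborel ?E \<le> ennreal (1 / q) * emeasure ?\<nu> ?E"
        using pq by (intro upper EB) auto
      also have "\<dots> \<le> ennreal (1 / q) * (ennreal p * emeasure lborel ?E)"
        using pq by (intro mult_left_mono lower EB) auto
      finally have "ennreal r \<le> ennreal (1 / q * (p * r))"
        using r pq by (simp only: ennreal_mult' r(1) zero_le_divide_1_iff less_imp_le)
      then have "r \<le> 1 / q * (p * r)" using r pq by (subst (asm) ennreal_le_iff) auto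
      then have "(q - p) * r \<le> 0" using pq by (simp add: field_simps)
      then have "r \<le> 0" using pq by (simp add: mult_le_0_iff)
      then show ?thesis using r by simp
    qed
    show ?thesis using LB UB z by (intro null_sets_bounded_parts) auto
  qed
  define I where "I = (\<Inter>k::nat. U (real (Suc k)))"
  have IB: "I \<in> sets borel" unfolding I_def using UB by auto
  have null2: "I \<in> null_sets lborel"
  proof -
    have z: "emeasure lborel (I \<inter> {-real n..real n}) = 0" for n :: nat
    proof -
      let ?E = "I \<inter> {-real n..real n}"
      define g where "g = G (real n) - G (- real n)"
      have g: "g \<ge> 0" using Gm[of "-real n" "real n"] by (simp add: g_def)
      have EB: "?E \<in> sets borel" using IB by simp
      have "emeasure lborel ?E \<le> ennreal (g * inverse (real (Suc k)))" for k
      proof -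
        have "emeasure lborel ?E \<le> ennreal (1 / real (Suc k)) * emeasure ?\<nu> ?E"
          by (intro upper EB) (auto simp: I_def)
        also have "\<dots> \<le> ennreal (1 / real (Suc k)) * emeasure ?\<nu> {-real n..real n}"
          by (intro mult_left_mono emeasure_mono) auto
        also have "\<dots> = ennreal (1 / real (Suc k)) * ennreal g"
          using emeasure_interval_measure_ac(1)[OF G, of "-real n" "real n"] by (simp add: g_def)
        also have "\<dots> = ennreal (g * inverse (real (Suc k)))"
          by (subst ennreal_mult'[symmetric]) (auto simp: field_simps)
        finally show ?thesis .
      qed
      moreover have "(\<lambda>k. ennreal (g * inverse (real (Suc k)))) \<longlonglongrightarrow> ennreal (g * 0)"
        by (intro tendsto_ennrealI tendsto_mult tendsto_const LIMSEQ_inverse_real_of_nat)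
      ultimately have "emeasure lborel ?E \<le> ennreal (g * 0)"
        by (intro LIMSEQ_le_const) auto
      then show ?thesis by simp
    qed
    show ?thesis using IB z by (intro null_sets_bounded_parts) auto
  qed
  define Z where "Z = I \<union> (\<Union>(p, q)\<in>{(p, q). (p, q) \<in> \<rat> \<times> \<rat> \<and> 0 \<le> p \<and> p < q}. L p \<inter> U q)"
  have "countable {(p, q). (p, q) \<in> \<rat> \<times> \<rat> \<and> 0 \<le> p \<and> p < (q::real)}"
    by (rule countable_subset[OF _ countable_SIGMA[OF countable_rat countable_rat]]) auto
  then have Z: "Z \<in> null_sets lborel"
    unfolding Z_def using null1 null2 by (intro null_sets.Un null_sets_UN') auto
  have diff: "G differentiable (at x)" if x: "x \<notin> Z" for x
  proof -
    obtain k where k: "x \<notin> U (real (Suc k))" using x by (auto simp: Z_def I_def)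
    have anti: "x \<in> U q" if h: "x \<in> U q'" "q \<le> q'" for q q'
      unfolding U_def
    proof (intro CollectI allI impI)
      fix d :: real assume "d > 0"
      then obtain u v where uv: "u < x" "x < v" "v - u < d" "q' * (v - u) \<le> G v - G u"
        using h(1) unfolding U_def by blast
      have "q * (v - u) \<le> q' * (v - u)" using h(2) uv by (intro mult_right_mono) auto
      then have "q * (v - u) \<le> G v - G u" using uv(4) by (rule order_trans)
      then show "\<exists>u v. u < x \<and> x < v \<and> v - u < d \<and> q * (v - u) \<le> G v - G u"
        using uv by blast
    qed
    have zero: "x \<in> U 0"
      unfolding U_def
    proof (intro CollectI allI impI)
      fix d :: real assume "d > 0"
      then show "\<exists>u v. u < x \<and> x < v \<and> v - u < d \<and> 0 * (v - u) \<le> G v - G u"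
        using Gm[of "x - d/3" "x + d/3"] by (intro exI[of _ "x - d/3"] exI[of _ "x + d/3"]) auto
    qed
    \<comment> \<open>The upper derivate at \<open>x\<close>; it is finite, and it is the derivative.\<close>
    define s where "s = Sup {q. x \<in> U q}"
    have bdd: "bdd_above {q. x \<in> U q}"
      using k anti by (intro bdd_aboveI[of _ "real (Suc k)"]) (metis mem_Collect_eq linear)
    have up: "\<exists>d>0. \<forall>u v. u \<le> x \<longrightarrow> x \<le> v \<longrightarrow> v - u < d \<longrightarrow> G v - G u \<le> (s + e) * (v - u)" if e: "e > 0" for e
    proof -
      have "x \<notin> U (s + e)"
      proof
        assume "x \<in> U (s + e)"
        then have "s + e \<le> s" unfolding s_def by (intro cSup_upper bdd) auto
        then show False using e by simp
      qed
      then obtain d where d: "d > 0" "\<And>u v. u < x \<Longrightarrow> x < v \<Longrightarrow> v - u < d \<Longrightarrow> \<not> (s + e) * (v - u) \<le> G v - G u"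
        unfolding U_def by blast
      show ?thesis
      proof (intro exI[of _ d] conjI d(1) allI impI)
        fix u v assume uv: "u \<le> x" "x \<le> v" "v - u < d"
        show "G v - G u \<le> (s + e) * (v - u)"
          by (rule slope_bound_closure[OF ac_increasing_continuous[OF G] _ uv]) (use d(2) in \<open>simp add: not_le less_imp_le\<close>)
      qed
    qed
    have lo: "\<exists>d>0. \<forall>u v. u \<le> x \<longrightarrow> x \<le> v \<longrightarrow> v - u < d \<longrightarrow> (s - e) * (v - u) \<le> G v - G u" if e: "e > 0" for e
    proof (cases "s - e \<le> 0")
      case True
      have "(s - e) * (v - u) \<le> G v - G u" if "u \<le> v" for u v
        using mult_nonpos_nonneg[OF True, of "v - u"] Gm[OF that] that by simp
      then show ?thesis by (intro exI[of _ 1]) auto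
    next
      case False
      \<comment> \<open>Rational \<open>p < q < s\<close>: from \<open>x \<in> U q\<close> and \<open>x \<notin> L p\<close>, all short slopes exceed \<open>p\<close>.\<close>
      obtain p where p: "p \<in> \<rat>" "s - e < p" "p < s" using Rats_dense_in_real[of "s - e" s] e by auto
      obtain q where q: "q \<in> \<rat>" "p < q" "q < s" using Rats_dense_in_real[OF p(3)] by auto
      obtain q' where q': "x \<in> U q'" "q < q'"
        using q(3) unfolding s_def by (subst (asm) less_cSup_iff) (use zero bdd in auto)
      have "x \<in> U q" by (rule anti[OF q'(1)]) (use q' in simp)
      then have "x \<notin> L p" using x p q False unfolding Z_def by auto
      then obtain d where d: "d > 0" "\<And>u v. u < x \<Longrightarrow> x < v \<Longrightarrow> v - u < d \<Longrightarrow> \<not> G v - G u \<le> p * (v - u)"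
        unfolding L_def by blast
      show ?thesis
      proof (intro exI[of _ d] conjI d(1) allI impI)
        fix u v assume uv: "u \<le> x" "x \<le> v" "v - u < d"
        have "- G v - - G u \<le> (- p) * (v - u)"
        proof (rule slope_bound_closure[OF _ _ uv, of "\<lambda>x. - G x"])
          show "continuous_on UNIV (\<lambda>x. - G x)"
            by (intro continuous_on_minus ac_increasing_continuous G)
          fix u v assume "u < x" "x < v" "v - u < d"
          from d(2)[OF this] show "- G v - - G u \<le> - p * (v - u)" by simp
        qed
        moreover have "(s - e) * (v - u) \<le> p * (v - u)"
          using p uv by (intro mult_right_mono) auto
        ultimately show "(s - e) * (v - u) \<le> G v - G u" by simp
      qed
    qed
    have "((\<lambda>y. (G y - G x) / (y - x)) \<longlongrightarrow> s) (at x)"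
      unfolding LIM_def
    proof (intro allI impI)
      fix e :: real assume e: "e > 0"
      obtain d1 where d1: "d1 > 0" "\<forall>u v. u \<le> x \<longrightarrow> x \<le> v \<longrightarrow> v - u < d1 \<longrightarrow> G v - G u \<le> (s + e / 2) * (v - u)"
        using up[of "e / 2"] e by auto
      obtain d2 where d2: "d2 > 0" "\<forall>u v. u \<le> x \<longrightarrow> x \<le> v \<longrightarrow> v - u < d2 \<longrightarrow> (s - e / 2) * (v - u) \<le> G v - G u"
        using lo[of "e / 2"] e by auto
      show "\<exists>d>0. \<forall>y. y \<noteq> x \<and> dist y x < d \<longrightarrow> dist ((G y - G x) / (y - x)) s < e"
      proof (intro exI[of _ "min d1 d2"] conjI allI impI)
        fix y assume y: "y \<noteq> x \<and> dist y x < min d1 d2"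
        have "s - e / 2 \<le> (G y - G x) / (y - x) \<and> (G y - G x) / (y - x) \<le> s + e / 2"
        proof (cases "x < y")
          case True
          then show ?thesis
            using d1(2)[rule_format, of x y] d2(2)[rule_format, of x y] y
            by (auto simp: dist_real_def pos_le_divide_eq pos_divide_le_eq)
        next
          case False
          then have "y < x" using y by simp
          moreover have "(G y - G x) / (y - x) = (G x - G y) / (x - y)"
            using minus_divide_divide[of "G x - G y" "x - y"] by simp
          ultimately show ?thesis
            using d1(2)[rule_format, of y x] d2(2)[rule_format, of y x] y
            by (auto simp: dist_real_def pos_le_divide_eq pos_divide_le_eq)
        qed
        then show "dist ((G y - G x) / (y - x)) s < e"
          using e unfolding dist_real_def abs_less_iff by linarith
      qed (use d1 d2 in auto)
    qed
    then show ?thesis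
      unfolding real_differentiable_def has_field_derivative_iff by blast
  qed
  show ?thesis by (rule AE_I'[OF Z]) (use diff in auto)
qed

section \<open>Tail integrals of a distribution\<close>

context real_distribution
begin

lemma emeasure_tail: "emeasure M {u<..} = ennreal (1 - cdf M u)"
proof -
  have "space M - {u<..} = {..u}" by auto
  then have "prob {u<..} = 1 - cdf M u"
    using prob_compl[of "{..u}"] by (simp add: cdf_def Compl_eq_Diff_UNIV[symmetric])
  then show ?thesis by (simp add: emeasure_eq_measure)
qed

text \<open>
  Tonelli's theorem for the region \<open>a \<le> u < x\<close>.
\<close>

lemma nn_integral_tail:
  "(\<integral>\<^sup>+u. ennreal (indicator {a..} u * (1 - cdf M u)) \<partial>lborel) = (\<integral>\<^sup>+x. ennreal (max (x - a) 0) \<partial>M)"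
proof -
  interpret P: pair_sigma_finite lborel M by standard
  have meas: "(\<lambda>(u, x). indicator {a..} u * indicator {u<..} x :: ennreal) \<in> borel_measurable (lborel \<Otimes>\<^sub>M M)"
  proof -
    have "{p \<in> space (borel \<Otimes>\<^sub>M borel). a \<le> fst p \<and> fst p < (snd p::real)} \<in> sets (borel \<Otimes>\<^sub>M borel)"
      by measurable
    then have *: "{p. a \<le> fst p \<and> fst p < (snd p::real)} \<in> sets (borel \<Otimes>\<^sub>M borel)"
      by (simp add: space_pair_measure)
    have eq: "(\<lambda>(u, x). indicator {a..} u * indicator {u<..} x :: ennreal) = indicator {p. a \<le> fst p \<and> fst p < snd p}"
      by (auto simp: fun_eq_iff split: split_indicator)
    have "sets (lborel \<Otimes>\<^sub>M M) = sets (borel \<Otimes>\<^sub>M borel)"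
      by (intro sets_pair_measure_cong) auto
    then show ?thesis unfolding eq using * by (intro borel_measurable_indicator) simp
  qed
  have "(\<integral>\<^sup>+u. ennreal (indicator {a..} u * (1 - cdf M u)) \<partial>lborel)
      = (\<integral>\<^sup>+u. (\<integral>\<^sup>+x. indicator {a..} u * indicator {u<..} x \<partial>M) \<partial>lborel)"
  proof (rule nn_integral_cong)
    fix u
    have "(\<integral>\<^sup>+x. indicator {a..} u * indicator {u<..} x \<partial>M) = indicator {a..} u * emeasure M {u<..}"
      by (simp add: nn_integral_cmult)
    then show "ennreal (indicator {a..} u * (1 - cdf M u)) = (\<integral>\<^sup>+x. indicator {a..} u * indicator {u<..} x \<partial>M)"
      by (simp add: emeasure_tail split: split_indicator)
  qed
  also have "\<dots> = (\<integral>\<^sup>+x. (\<integral>\<^sup>+u. indicator {a..} u * indicator {u<..} x \<partial>lborel) \<partial>M)"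
    using P.Fubini'[OF meas] by simp
  also have "\<dots> = (\<integral>\<^sup>+x. ennreal (max (x - a) 0) \<partial>M)"
  proof (rule nn_integral_cong)
    fix x
    have "(\<integral>\<^sup>+u. indicator {a..} u * indicator {u<..} x \<partial>lborel) = (\<integral>\<^sup>+u. indicator {a..<x} u \<partial>lborel)"
      by (intro nn_integral_cong) (auto split: split_indicator)
    also have "\<dots> = ennreal (max (x - a) 0)" by (auto simp: max_def)
    finally show "(\<integral>\<^sup>+u. indicator {a..} u * indicator {u<..} x \<partial>lborel) = ennreal (max (x - a) 0)" .
  qed
  finally show ?thesis .
qed

lemma cdf_borel [measurable]: "cdf M \<in> borel_measurable borel"
  by (rule borel_measurable_mono) (simp add: mono_def cdf_nondecreasing)

lemma integrable_max_shift:
  assumes "integrable M (\<lambda>x. max (x - a) 0)"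
  shows "integrable M (\<lambda>x. max (x - b) 0)"
proof (rule Bochner_Integration.integrable_bound)
  show "integrable M (\<lambda>x. max (x - a) 0 + \<bar>a - b\<bar>)" using assms by simp
  show "AE x in M. norm (max (x - b) 0) \<le> norm (max (x - a) 0 + \<bar>a - b\<bar>)"
    by (intro always_eventually) auto
qed simp

lemma tail_integrable_iff:
  "set_integrable lborel {a..} (\<lambda>u. 1 - cdf M u) \<longleftrightarrow> integrable M (\<lambda>x. max x 0)"
proof -
  have "set_integrable lborel {a..} (\<lambda>u. 1 - cdf M u) \<longleftrightarrow>
      (\<integral>\<^sup>+u. ennreal (indicator {a..} u * (1 - cdf M u)) \<partial>lborel) < \<infinity>"
    unfolding set_integrable_def
    by (subst integrable_iff_bounded) (auto simp: cdf_bounded_prob)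
  also have "\<dots> \<longleftrightarrow> integrable M (\<lambda>x. max (x - a) 0)"
    unfolding nn_integral_tail by (subst integrable_iff_bounded) auto
  also have "\<dots> \<longleftrightarrow> integrable M (\<lambda>x. max x 0)"
    using integrable_max_shift[of a 0] integrable_max_shift[of 0 a] by auto
  finally show ?thesis .
qed

lemma tail_set_integrable:
  assumes "A \<in> sets borel" "emeasure lborel A < \<infinity>"
  shows "set_integrable lborel A (\<lambda>u. 1 - cdf M u)"
  unfolding set_integrable_def
proof (rule Bochner_Integration.integrable_bound)
  show "integrable lborel (indicator A :: real \<Rightarrow> real)" using assms by simp
  show "AE x in lborel. norm (indicator A x *\<^sub>R (1 - cdf M x)) \<le> norm (indicator A x :: real)"
    by (intro always_eventually) (auto simp: cdf_nonneg cdf_bounded_prob split: split_indicator)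
qed (use assms in simp)

lemma tail_increment_bounds:
  assumes "x \<le> y"
  shows "(1 - cdf M y) * (y - x) \<le> (LBINT u:{x..<y}. 1 - cdf M u)"
    and "(LBINT u:{x..<y}. 1 - cdf M u) \<le> (1 - cdf M x) * (y - x)"
proof -
  have i: "set_integrable lborel {x..<y} (\<lambda>u. 1 - cdf M u)"
    using assms by (intro tail_set_integrable) auto
  have "(1 - cdf M y) * (y - x) \<le> (LBINT u:{x..<y}. 1 - cdf M u) \<and>
      (LBINT u:{x..<y}. 1 - cdf M u) \<le> (1 - cdf M x) * (y - x)"
    using set_integral_bounds[OF i _ _ assms, of "1 - cdf M y" "1 - cdf M x"] assms
    by (auto simp: cdf_nondecreasing)
  then show "(1 - cdf M y) * (y - x) \<le> (LBINT u:{x..<y}. 1 - cdf M u)"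
    and "(LBINT u:{x..<y}. 1 - cdf M u) \<le> (1 - cdf M x) * (y - x)" by auto
qed

lemma tail_integral_split:
  assumes "c \<le> x" "x \<le> y"
  shows "(LBINT u:{c..<y}. 1 - cdf M u) = (LBINT u:{c..<x}. 1 - cdf M u) + (LBINT u:{x..<y}. 1 - cdf M u)"
proof -
  have "{c..<y} = {c..<x} \<union> {x..<y}" using assms by auto
  then show ?thesis
    using set_integral_Un[of "{c..<x}" "{x..<y}" lborel "\<lambda>u. 1 - cdf M u"] assms
    by (auto simp: tail_set_integrable)
qed

text \<open>
  \<open>P\<close> plus the tail integral has increments bounded by those of \<open>1 - cdf M\<close> times the length, so it is constant.
\<close>

lemma tail_integral_unique:
  assumes "a \<le> b"
    and P: "\<And>x y. a \<le> x \<Longrightarrow> x \<le> y \<Longrightarrow> y \<le> b \<Longrightarrow> (1 - cdf M y) * (y - x) \<le> P x - P y"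
      "\<And>x y. a \<le> x \<Longrightarrow> x \<le> y \<Longrightarrow> y \<le> b \<Longrightarrow> P x - P y \<le> (1 - cdf M x) * (y - x)"
  shows "(LBINT u:{a..<b}. 1 - cdf M u) = P a - P b"
proof -
  let ?T = "\<lambda>x. LBINT u:{a..<x}. 1 - cdf M u"
  have "P a + ?T a = P b + ?T b"
  proof (rule telescoping_increments_eq[OF \<open>a \<le> b\<close>, of "\<lambda>x. P x + ?T x" "\<lambda>x. 1 - cdf M x"])
    fix x y assume xy: "a \<le> x" "x \<le> y" "y \<le> b"
    have "?T y - ?T x = (LBINT u:{x..<y}. 1 - cdf M u)" using tail_integral_split[OF xy(1,2)] by simp
    then show "\<bar>P y + ?T y - (P x + ?T x)\<bar> \<le> (1 - cdf M x - (1 - cdf M y)) * (y - x)"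
      using tail_increment_bounds[OF xy(2)] P[OF xy] by (auto simp: algebra_simps abs_le_iff)
  qed
  then show ?thesis by (simp add: set_lebesgue_integral_def)
qed

text \<open>
  Monotone convergence. For bounded offers the levels \<open>y n\<close> approach the point beyond which the tail
  vanishes, and for unbounded ones they tend to infinity; \<open>top\<close> covers both cases.
\<close>

lemma phi_from_limit:
  assumes y: "incseq y" "\<And>n. c \<le> y n" and top: "\<And>u. (\<And>n. y n \<le> u) \<Longrightarrow> cdf M u = 1"
    and lim: "(\<lambda>n. LBINT u:{c..<y n}. 1 - cdf M u) \<longlonglongrightarrow> l"
  shows "set_integrable lborel {c..} (\<lambda>u. 1 - cdf M u)" and "phi M c = l"
proof -
  let ?f = "\<lambda>n u. indicator {c..<y n} u *\<^sub>R (1 - cdf M u)"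
  let ?g = "\<lambda>u. indicator {c..} u *\<^sub>R (1 - cdf M u)"
  have 1: "integrable lborel (?f n)" for n
    using tail_set_integrable[of "{c..<y n}"] y(2)[of n] by (simp add: set_integrable_def)
  have 2: "AE u in lborel. mono (\<lambda>n. ?f n u)"
  proof (intro always_eventually allI monoI)
    fix u :: real and m n :: nat assume "m \<le> n"
    then have "y m \<le> y n" using y(1) by (auto simp: incseq_def)
    then show "?f m u \<le> ?f n u" by (auto simp: cdf_bounded_prob split: split_indicator)
  qed
  have 3: "AE u in lborel. (\<lambda>n. ?f n u) \<longlonglongrightarrow> ?g u"
  proof (intro always_eventually allI)
    fix u :: real
    show "(\<lambda>n. ?f n u) \<longlonglongrightarrow> ?g u"
    proof (cases "\<exists>N. u < y N")
      case True
      then obtain N where N: "u < y N" by blast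
      have "u < y n" if "n \<ge> N" for n using N y(1) that by (auto simp: incseq_def intro: less_le_trans)
      then have "eventually (\<lambda>n. ?f n u = ?g u) sequentially"
        by (intro eventually_sequentiallyI[of N]) (auto split: split_indicator)
      then show ?thesis by (rule tendsto_eventually)
    next
      case False
      then have "cdf M u = 1" by (intro top) (auto simp: not_less)
      then show ?thesis by simp
    qed
  qed
  have 4: "(\<lambda>n. integral\<^sup>L lborel (?f n)) \<longlonglongrightarrow> l"
    using lim by (simp add: set_lebesgue_integral_def)
  have 5: "?g \<in> borel_measurable lborel" by measurable
  show "set_integrable lborel {c..} (\<lambda>u. 1 - cdf M u)"
    unfolding set_integrable_def by (rule integrable_monotone_convergence[OF 1 2 3 4 5])
  show "phi M c = l"
    unfolding phi_def set_lebesgue_integral_def by (rule integral_monotone_convergence[OF 1 2 3 4 5])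
qed

lemma phi_increment:
  assumes int: "integrable M (\<lambda>x. max x 0)" and "x \<le> y"
  shows "phi M x - phi M y = (LBINT u:{x..<y}. 1 - cdf M u)"
proof -
  have "{x..} = {x..<y} \<union> {y..}" "{x..<y} \<inter> {y..} = {}" using assms by auto
  then show ?thesis
    using set_integral_Un[of "{x..<y}" "{y..}" lborel "\<lambda>u. 1 - cdf M u"] assms
    by (auto simp: tail_set_integrable tail_integrable_iff phi_def)
qed

lemma phi_sandwich:
  assumes int: "integrable M (\<lambda>x. max x 0)" and "x \<le> y"
  shows "(1 - cdf M y) * (y - x) \<le> phi M x - phi M y" and "phi M x - phi M y \<le> (1 - cdf M x) * (y - x)"
  using tail_increment_bounds[OF assms(2)] phi_increment[OF assms] by auto

lemma phi_nonneg: "0 \<le> phi M x"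
  unfolding phi_def set_lebesgue_integral_def
  by (rule integral_nonneg_AE, rule always_eventually) (auto simp: cdf_bounded_prob)

lemma phi_antimono:
  assumes int: "integrable M (\<lambda>x. max x 0)" and "x \<le> y"
  shows "phi M y \<le> phi M x"
  using phi_sandwich(1)[OF assms] assms(2) cdf_bounded_prob[of y]
    mult_nonneg_nonneg[of "1 - cdf M y" "y - x"] by linarith

lemma phi_pos:
  assumes int: "integrable M (\<lambda>x. max x 0)" and "ereal x < upper_end M"
  shows "0 < phi M x"
proof -
  obtain y where y: "ereal x < ereal y" "cdf M y < 1"
    using assms(2) unfolding upper_end_def less_Sup_iff by auto
  then have "0 < (1 - cdf M y) * (y - x)" by simp
  then show ?thesis using phi_sandwich(1)[OF int, of x y] phi_nonneg[of y] y(1) by simp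
qed

lemma cdf_less_1: "ereal x < upper_end M \<Longrightarrow> cdf M x < 1"
  unfolding upper_end_def less_Sup_iff
proof (elim bexE)
  fix a assume "a \<in> {ereal x |x. cdf M x < 1}" "ereal x < a"
  then obtain y where "x < y" "cdf M y < 1" by auto
  then show "cdf M x < 1" using cdf_nondecreasing[of x y] by simp
qed

lemma cdf_eq_1: "upper_end M < ereal x \<Longrightarrow> cdf M x = 1"
proof (rule ccontr)
  assume "upper_end M < ereal x" "cdf M x \<noteq> 1"
  then have "cdf M x < 1" using cdf_bounded_prob[of x] by simp
  then have "ereal x \<le> upper_end M" unfolding upper_end_def by (intro Sup_upper) auto
  then show False using \<open>upper_end M < ereal x\<close> by simp
qed

lemma phi_antimono_strict:
  assumes int: "integrable M (\<lambda>x. max x 0)" and "x < y" "ereal y < upper_end M"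
  shows "phi M y < phi M x"
proof -
  have "0 < (1 - cdf M y) * (y - x)" using cdf_less_1[OF assms(3)] assms(2) by simp
  then show ?thesis using phi_sandwich(1)[OF int, of x y] assms(2) by simp
qed

lemma phi_le_bounded:
  assumes int: "integrable M (\<lambda>x. max x 0)" and "upper_end M \<le> ereal m" "x \<le> m"
  shows "phi M x \<le> m - x"
proof -
  have top: "cdf M u = 1" if "m < u" for u
    using assms(2) that by (intro cdf_eq_1) (simp add: le_less_trans)
  have "phi M m = (LBINT u:{m..}. 0)"
    unfolding phi_def set_lebesgue_integral_def
  proof (rule integral_cong_AE)
    have "AE u in lborel. u \<noteq> m" by (rule AE_lborel_singleton)
    then show "AE u in lborel. indicator {m..} u *\<^sub>R (1 - cdf M u) = indicator {m..} u *\<^sub>R 0"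
      by eventually_elim (use top in \<open>auto split: split_indicator\<close>)
  qed (use cdf_borel in measurable)
  then have "phi M m = 0" by (simp add: set_lebesgue_integral_def)
  moreover have "(1 - cdf M x) * (m - x) \<le> 1 * (m - x)"
    using assms(3) cdf_nonneg[of x] by (intro mult_right_mono) auto
  ultimately show ?thesis using phi_sandwich(2)[OF int assms(3)] by simp
qed

end

section \<open>Properties of the optimal policy\<close>

lemma at_within_atLeast_neq_bot:
  assumes "(0::real) \<le> t"
  shows "at t within {0..} \<noteq> bot"
proof
  assume "at t within {0..} = bot"
  moreover have "at_right t \<le> at t within {0..}" using assms by (intro at_le) auto
  ultimately have "at_right t = bot" by (simp add: bot_unique)
  then show False by simp
qed

lemma hderiv_eqI:
  assumes "0 \<le> t" "(f has_real_derivative d) (at t within {0..})"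
  shows "hderiv f t = d"
  unfolding hderiv_def
  by (rule vector_derivative_within[OF at_within_atLeast_neq_bot[OF assms(1)]])
     (use assms(2) in \<open>simp add: has_real_derivative_iff_has_vector_derivative\<close>)

lemma hderiv_works:
  assumes "0 \<le> t" "f differentiable (at t within {0..})"
  shows "(f has_real_derivative hderiv f t) (at t within {0..})"
proof -
  obtain d where "(f has_real_derivative d) (at t within {0..})"
    using assms(2) unfolding real_differentiable_def by blast
  then show ?thesis using hderiv_eqI[OF assms(1)] by simp
qed

text \<open>
  The direct part. \<open>levels\<close> is the interval \<open>[\<mu>\<^sub>0, M)\<close> of thresholds.
\<close>

locale sale =
  fixes F F0 :: "real measure" and lam :: real
  assumes sp: "sale_problem F F0 lam"
begin

sublocale real_distribution F using sp by (simp add: sale_problem_def)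

abbreviation "m \<equiv> mean F0"
definition levels where "levels = {x. m \<le> x \<and> ereal x < upper_end F}"
definition \<mu> where "\<mu> = optimal_policy F F0 lam"

lemma lam_pos: "0 < lam" using sp by (simp add: sale_problem_def)
lemma offers_integrable: "integrable F (\<lambda>x. max x 0)" using sp by (simp add: sale_problem_def)
lemma m_nonneg: "0 \<le> m" using sp by (simp add: sale_problem_def)
lemma m_levels: "m \<in> levels" using sp by (simp add: sale_problem_def levels_def)
lemma levels_down: "x \<in> levels \<Longrightarrow> m \<le> z \<Longrightarrow> z \<le> x \<Longrightarrow> z \<in> levels"
  unfolding levels_def by (auto intro: le_less_trans[of "ereal z" "ereal x"])
lemma phi_pos_levels: "x \<in> levels \<Longrightarrow> 0 < phi F x" using phi_pos[OF offers_integrable] by (simp add: levels_def)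

lemma phi_continuous: "continuous_on UNIV (phi F)"
proof (rule lipschitz_on_continuous_on)
  have *: "dist (phi F x) (phi F y) \<le> 1 * dist x y" if "x \<le> y" for x y
  proof -
    have "(1 - cdf F x) * (y - x) \<le> 1 * (y - x)" using that cdf_nonneg[of x] by (intro mult_right_mono) auto
    then show ?thesis
      using phi_sandwich(2)[OF offers_integrable that] phi_antimono[OF offers_integrable that] that by (simp add: dist_real_def)
  qed
  show "1-lipschitz_on UNIV (phi F)"
  proof (rule lipschitz_onI)
    show "dist (phi F x) (phi F y) \<le> 1 * dist x y" for x y
      using *[of x y] *[of y x] by (cases "x \<le> y") (auto simp: dist_commute)
  qed simp
qed

lemma inverse_phi_integrable:
  assumes "x \<in> levels" "A \<in> sets borel" "A \<subseteq> {m..x}"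
  shows "set_integrable lborel A (\<lambda>u. 1 / phi F u)"
proof (rule set_integrable_subset[of _ "{m..x}"])
  have "continuous_on {m..x} (\<lambda>u. 1 / phi F u)"
  proof (intro continuous_on_divide continuous_on_const continuous_on_subset[OF phi_continuous])
    show "\<forall>u\<in>{m..x}. phi F u \<noteq> 0"
    proof
      fix u assume "u \<in> {m..x}"
      then have "u \<in> levels" using levels_down[OF assms(1)] by auto
      then show "phi F u \<noteq> 0" using phi_pos_levels[of u] by simp
    qed
  qed simp
  then show "set_integrable lborel {m..x} (\<lambda>u. 1 / phi F u)"
    unfolding set_integrable_def by (intro borel_integrable_compact) auto
qed (use assms in auto)

lemma Psi_sandwich:
  assumes "m \<le> x" "x \<le> y" "y \<in> levels"
  shows "1 / phi F x * (y - x) \<le> Psi F F0 y - Psi F F0 x" "Psi F F0 y - Psi F F0 x \<le> 1 / phi F y * (y - x)"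
proof -
  have "{m..y} = {m..x} \<union> {x<..y}" "{m..x} \<inter> {x<..y} = {}" using assms by auto
  then have eq: "Psi F F0 y - Psi F F0 x = (LBINT u:{x<..y}. 1 / phi F u)"
    using set_integral_Un[of "{m..x}" "{x<..y}" lborel "\<lambda>u. 1 / phi F u"] assms
      inverse_phi_integrable[OF assms(3)]
    by (simp add: Psi_def)
  have b: "1 / phi F x \<le> 1 / phi F u \<and> 1 / phi F u \<le> 1 / phi F y" if "u \<in> {x<..y}" for u
  proof -
    have "0 < phi F y" "0 < phi F u" using phi_pos_levels assms(3) levels_down[OF assms(3), of u] that assms by auto
    moreover have "phi F u \<le> phi F x" "phi F y \<le> phi F u" using that by (auto intro!: phi_antimono[OF offers_integrable])
    ultimately show ?thesis by (auto intro!: divide_left_mono)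
  qed
  have i: "set_integrable lborel {x<..y} (\<lambda>u. 1 / phi F u)"
    by (rule inverse_phi_integrable[OF assms(3)]) (use assms in auto)
  have em: "emeasure lborel {x<..y} = ennreal (y - x)" using assms by simp
  show "1 / phi F x * (y - x) \<le> Psi F F0 y - Psi F F0 x" "Psi F F0 y - Psi F F0 x \<le> 1 / phi F y * (y - x)"
    unfolding eq using set_integral_bounds[OF i _ em assms(2), of "1 / phi F x" "1 / phi F y"] b by auto
qed

lemma Psi_m: "Psi F F0 m = 0"
proof -
  have i: "set_integrable lborel {m..m} (\<lambda>u. 1 / phi F u)"
    by (rule inverse_phi_integrable[OF m_levels]) auto
  show ?thesis
    using set_integral_bounds[OF i, of m m "1 / phi F m" "1 / phi F m"] by (simp add: Psi_def)
qed

lemma Psi_strict_mono: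
  assumes "x \<in> levels" "y \<in> levels" "x < y"
  shows "Psi F F0 x < Psi F F0 y"
proof -
  have "0 < 1 / phi F x * (y - x)" using phi_pos_levels[OF assms(1)] assms(3) by simp
  then show ?thesis using Psi_sandwich(1)[of x y] assms by (simp add: levels_def)
qed

lemma Psi_inj: "inj_on (Psi F F0) levels"
  by (rule linorder_inj_onI) (auto dest: Psi_strict_mono)

lemma Psi_less_iff: "x \<in> levels \<Longrightarrow> y \<in> levels \<Longrightarrow> Psi F F0 x < Psi F F0 y \<longleftrightarrow> x < y"
  using Psi_strict_mono[of x y] Psi_strict_mono[of y x] by (cases x y rule: linorder_cases) auto

lemma Psi_has_derivative:
  assumes "x \<in> levels"
  shows "(Psi F F0 has_real_derivative 1 / phi F x) (at x within levels)"
proof -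
  have "((\<lambda>x. - Psi F F0 x) has_real_derivative - (1 / phi F x)) (at x within levels)"
  proof (rule sandwich_has_derivative[of levels "\<lambda>x. - (1 / phi F x)"])
    fix x y assume *: "x \<in> levels" "y \<in> levels" "x \<le> y"
    show "- (1 / phi F y) * (y - x) \<le> - Psi F F0 y - - Psi F F0 x"
      using Psi_sandwich(2)[of x y] * by (simp add: levels_def)
    show "- Psi F F0 y - - Psi F F0 x \<le> - (1 / phi F x) * (y - x)"
      using Psi_sandwich(1)[of x y] * by (simp add: levels_def)
  next
    have "(phi F \<longlongrightarrow> phi F x) (at x within levels)"
      using continuous_on_subset[OF phi_continuous, of levels] assms by (simp add: continuous_on_def)
    then show "((\<lambda>x. - (1 / phi F x)) \<longlongrightarrow> - (1 / phi F x)) (at x within levels)"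
      using phi_pos_levels[OF assms] by (intro tendsto_intros) auto
  qed (use assms in auto)
  from DERIV_minus[OF this] show ?thesis by simp
qed

text \<open>
  If \<open>M\<close> is infinite, \<open>\<Psi>\<close> grows at least linearly with slope \<open>1/\<phi>(\<mu>\<^sub>0)\<close>. If \<open>M = r\<close> is finite, each halving of
  the distance to \<open>r\<close> increases \<open>\<Psi>\<close> by at least \<open>1/2\<close>, since \<open>\<phi>(x) \<le> r - x\<close>.
\<close>

lemma Psi_unbounded: "\<exists>x\<in>levels. s \<le> Psi F F0 x"
proof (cases "upper_end F")
  case (real r)
  have mr: "m < r" using m_levels real by (simp add: levels_def)
  \<comment> \<open>Levels that halve the remaining distance to the upper end.\<close>
  define x where "x k = r - (r - m) / 2 ^ k" for k :: nat
  have xI: "x k \<in> levels" for k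
  proof -
    have "(r - m) / 2 ^ k \<le> (r - m) / 1" using mr by (intro divide_left_mono) auto
    then show ?thesis using mr by (auto simp: levels_def x_def real)
  qed
  have step: "1 / 2 \<le> Psi F F0 (x (Suc k)) - Psi F F0 (x k)" for k
  proof -
    define d where "d = (r - m) / 2 ^ Suc k"
    have d: "d > 0" using mr by (simp add: d_def)
    have xs: "x (Suc k) - x k = d" by (simp add: x_def d_def field_simps)
    have "phi F (x k) \<le> r - x k"
      using xI[of k] by (intro phi_le_bounded[OF offers_integrable]) (auto simp: real levels_def)
    also have "r - x k = 2 * d" by (simp add: x_def d_def field_simps)
    finally have "1 / (2 * d) * d \<le> 1 / phi F (x k) * d"
      using phi_pos_levels[OF xI[of k]] d by (intro mult_right_mono divide_left_mono) auto
    then have "1 / 2 \<le> 1 / phi F (x k) * (x (Suc k) - x k)" using d unfolding xs by simp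
    also have "\<dots> \<le> Psi F F0 (x (Suc k)) - Psi F F0 (x k)"
      using xI[of k] xI[of "Suc k"] xs d by (intro Psi_sandwich) (auto simp: levels_def)
    finally show ?thesis .
  qed
  have "real k / 2 \<le> Psi F F0 (x k)" for k
  proof (induction k)
    case 0
    then show ?case by (simp add: x_def Psi_m)
  next
    case (Suc k)
    then show ?case using step[of k] by (simp add: add_divide_distrib)
  qed
  note growth = this
  obtain k :: nat where "2 * s \<le> real k" using real_arch_simple by blast
  then have "s \<le> Psi F F0 (x k)" using growth[of k] by simp
  then show ?thesis using xI by blast
next
  case PInf
  define x where "x = m + max s 0 * phi F m"
  have p: "phi F m > 0" by (rule phi_pos_levels[OF m_levels])
  have x: "x \<in> levels" "m \<le> x" using p by (auto simp: levels_def PInf x_def)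
  have "1 / phi F m * (x - m) = max s 0" using p by (simp add: x_def)
  then have "s \<le> Psi F F0 x" using Psi_sandwich(1)[of m x] x Psi_m by simp
  then show ?thesis using x by blast
next
  case MInf
  then show ?thesis using m_levels by (simp add: levels_def)
qed

lemma Psi_surj:
  assumes "0 \<le> s"
  shows "s \<in> Psi F F0 ` levels"
proof -
  obtain y where y: "y \<in> levels" "s \<le> Psi F F0 y" using Psi_unbounded by blast
  have "continuous_on levels (Psi F F0)"
    by (rule DERIV_continuous_on) (rule Psi_has_derivative)
  then have c: "continuous_on {m..y} (Psi F F0)"
    by (rule continuous_on_subset) (use levels_down[OF y(1)] in auto)
  have "\<exists>x\<ge>m. x \<le> y \<and> Psi F F0 x = s"
    by (rule IVT'[OF _ y(2) _ c]) (use assms y Psi_m in \<open>auto simp: levels_def\<close>)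
  then show ?thesis using levels_down[OF y(1)] by blast
qed

lemma mu_levels: "0 \<le> t \<Longrightarrow> \<mu> t \<in> levels"
  and Psi_mu: "0 \<le> t \<Longrightarrow> Psi F F0 (\<mu> t) = lam * t"
proof -
  assume "0 \<le> t"
  then have s: "lam * t \<in> Psi F F0 ` levels" using lam_pos by (intro Psi_surj) simp
  show "\<mu> t \<in> levels" unfolding \<mu>_def optimal_policy_def levels_def[symmetric]
    by (rule the_inv_into_into[OF Psi_inj s]) simp
  show "Psi F F0 (\<mu> t) = lam * t" unfolding \<mu>_def optimal_policy_def levels_def[symmetric]
    by (rule f_the_inv_into_f[OF Psi_inj s])
qed

lemma mu_eqI: "x \<in> levels \<Longrightarrow> Psi F F0 x = lam * t \<Longrightarrow> \<mu> t = x"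
  unfolding \<mu>_def optimal_policy_def levels_def[symmetric] by (rule the_inv_into_f_eq[OF Psi_inj])

lemma mu_0: "\<mu> 0 = m"
  by (rule mu_eqI) (auto simp: m_levels Psi_m)

lemma mu_less: "0 \<le> s \<Longrightarrow> s < t \<Longrightarrow> \<mu> s < \<mu> t"
  using Psi_less_iff[OF mu_levels mu_levels, of s t] Psi_mu[of s] Psi_mu[of t] lam_pos by simp

lemma mu_le: "0 \<le> s \<Longrightarrow> s \<le> t \<Longrightarrow> \<mu> s \<le> \<mu> t"
  using mu_less[of s t] by (cases "s = t") auto

lemma mu_sandwich:
  assumes "0 \<le> s" "s \<le> t"
  shows "lam * phi F (\<mu> t) * (t - s) \<le> \<mu> t - \<mu> s" "\<mu> t - \<mu> s \<le> lam * phi F (\<mu> s) * (t - s)"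
proof -
  have levels: "\<mu> s \<in> levels" "\<mu> t \<in> levels" using assms mu_levels by auto
  have p: "0 < phi F (\<mu> s)" "0 < phi F (\<mu> t)" using phi_pos_levels levels by auto
  have "1 / phi F (\<mu> s) * (\<mu> t - \<mu> s) \<le> lam * t - lam * s"
    "lam * t - lam * s \<le> 1 / phi F (\<mu> t) * (\<mu> t - \<mu> s)"
    using Psi_sandwich[of "\<mu> s" "\<mu> t"] levels mu_le[OF assms] Psi_mu[of s] Psi_mu[of t] assms
    by (auto simp: levels_def)
  then show "lam * phi F (\<mu> t) * (t - s) \<le> \<mu> t - \<mu> s" "\<mu> t - \<mu> s \<le> lam * phi F (\<mu> s) * (t - s)"
    using p by (auto simp: field_simps)
qed

lemma phi_mu_le: "0 \<le> t \<Longrightarrow> phi F (\<mu> t) \<le> phi F m"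
  using mu_levels[of t] by (intro phi_antimono[OF offers_integrable]) (simp add: levels_def)

lemma mu_lipschitz:
  assumes "0 \<le> s" "s \<le> t"
  shows "\<mu> t - \<mu> s \<le> lam * phi F m * (t - s)"
proof -
  have "lam * phi F (\<mu> s) * (t - s) \<le> lam * phi F m * (t - s)"
    using lam_pos phi_mu_le[OF assms(1)] assms by (intro mult_right_mono mult_left_mono) auto
  then show ?thesis using mu_sandwich(2)[OF assms] by simp
qed

lemma mu_continuous: "continuous_on {0..} \<mu>"
proof (rule lipschitz_on_continuous_on)
  show "(lam * phi F m)-lipschitz_on {0..} \<mu>"
  proof (rule lipschitz_onI)
    fix s t :: real assume "s \<in> {0..}" "t \<in> {0..}"
    then show "dist (\<mu> s) (\<mu> t) \<le> lam * phi F m * dist s t"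
      using mu_lipschitz[of s t] mu_lipschitz[of t s] mu_le[of s t] mu_le[of t s]
      by (cases "s \<le> t") (auto simp: dist_real_def)
  qed (use lam_pos phi_nonneg in simp)
qed

lemma phi_mu_continuous: "continuous_on {0..} (\<lambda>t. lam * phi F (\<mu> t))"
  by (intro continuous_on_mult continuous_on_const continuous_on_compose2[OF phi_continuous mu_continuous]) simp

lemma mu_has_derivative:
  assumes "0 \<le> t"
  shows "(\<mu> has_real_derivative lam * phi F (\<mu> t)) (at t within {0..})"
proof (rule sandwich_has_derivative[of "{0..}" "\<lambda>t. lam * phi F (\<mu> t)"])
  show "((\<lambda>t. lam * phi F (\<mu> t)) \<longlongrightarrow> lam * phi F (\<mu> t)) (at t within {0..})"
    using phi_mu_continuous assms by (simp add: continuous_on_def)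
qed (use assms mu_sandwich in auto)

lemma hderiv_mu: "0 \<le> t \<Longrightarrow> hderiv \<mu> t = lam * phi F (\<mu> t)"
  by (intro hderiv_eqI mu_has_derivative)

lemma hderiv_mu_pos: "0 \<le> t \<Longrightarrow> 0 < hderiv \<mu> t"
  using hderiv_mu[of t] phi_pos_levels[OF mu_levels, of t] lam_pos by simp

lemma mu_C1: "C1_halfline \<mu>"
  unfolding C1_halfline_def
proof
  show "\<mu> differentiable_on {0..}"
    unfolding differentiable_on_def real_differentiable_def using mu_has_derivative by auto
  show "continuous_on {0..} (hderiv \<mu>)"
    using phi_mu_continuous by (rule continuous_on_eq) (simp add: hderiv_mu)
qed

lemma mu_limit: "((\<lambda>t. ereal (\<mu> t)) \<longlongrightarrow> upper_end F) at_top"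
proof (rule order_tendstoI)
  fix a assume "a < upper_end F"
  then have "max a (ereal m) < upper_end F" using m_levels by (simp add: levels_def)
  then obtain z where "max a (ereal m) < z" "z < upper_end F" using dense by blast
  then have "a < z" "ereal m < z" "z < upper_end F" by auto
  then obtain x where x: "a < ereal x" "m < x" "ereal x < upper_end F"
    by (cases z) auto
  then have xI: "x \<in> levels" by (simp add: levels_def)
  show "eventually (\<lambda>t. a < ereal (\<mu> t)) at_top"
    using eventually_gt_at_top[of "max 0 (Psi F F0 x / lam)"]
  proof eventually_elim
    case (elim t)
    then have "Psi F F0 x < Psi F F0 (\<mu> t)"
      using Psi_mu[of t] lam_pos by (simp add: pos_divide_less_eq mult.commute)
    then have "x < \<mu> t" using Psi_less_iff[OF xI mu_levels, of t] elim by simp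
    then show ?case using x(1) by (auto intro: less_trans)
  qed
next
  fix a assume "upper_end F < a"
  show "eventually (\<lambda>t. ereal (\<mu> t) < a) at_top"
    using eventually_ge_at_top[of 0]
  proof eventually_elim
    case (elim t)
    then show ?case using mu_levels[of t] \<open>upper_end F < a\<close> by (auto simp: levels_def intro: less_trans)
  qed
qed

lemma hderiv_mu_abs_continuous: "abs_continuous_on {0..} (hderiv \<mu>)"
proof (rule lipschitz_abs_continuous_on)
  fix s t :: real assume "s \<in> {0..}" "t \<in> {0..}" "s \<le> t"
  then have st: "0 \<le> s" "s \<le> t" "0 \<le> t" by auto
  have le: "\<mu> s \<le> \<mu> t" using mu_le st by simp
  have "phi F (\<mu> s) - phi F (\<mu> t) \<le> (1 - cdf F (\<mu> s)) * (\<mu> t - \<mu> s)"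
    by (rule phi_sandwich(2)[OF offers_integrable le])
  also have "\<dots> \<le> 1 * (\<mu> t - \<mu> s)" using le cdf_nonneg[of "\<mu> s"] by (intro mult_right_mono) auto
  also have "\<dots> \<le> lam * phi F m * (t - s)" using mu_lipschitz[OF st(1,2)] by simp
  finally have "lam * (phi F (\<mu> s) - phi F (\<mu> t)) \<le> lam * (lam * phi F m * (t - s))"
    using lam_pos by (intro mult_left_mono) auto
  moreover have "lam * phi F (\<mu> t) \<le> lam * phi F (\<mu> s)"
    using lam_pos phi_antimono[OF offers_integrable le] by (intro mult_left_mono) auto
  ultimately show "\<bar>hderiv \<mu> t - hderiv \<mu> s\<bar> \<le> (lam * (lam * phi F m)) * (t - s)"
    using st by (simp add: hderiv_mu right_diff_distrib mult.assoc)
qed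

lemma mu_strictly_concave: "strictly_concave_on {0..} \<mu>"
proof (rule sandwich_strictly_concave[of _ "\<lambda>t. lam * phi F (\<mu> t)"])
  fix s t :: real assume st: "s \<in> {0..}" "t \<in> {0..}" "s < t"
  then have "phi F (\<mu> t) < phi F (\<mu> s)"
    using mu_less[of s t] mu_levels[of t] by (intro phi_antimono_strict[OF offers_integrable]) (auto simp: levels_def)
  then show "lam * phi F (\<mu> t) < lam * phi F (\<mu> s)" using lam_pos by simp
qed (use mu_sandwich in auto)

text \<open>
  The chain rule for \<open>\<lambda> \<phi>(\<mu>)\<close> within any set \<open>T\<close> of times for which \<open>F\<close> is continuous at \<open>\<mu> t\<close> along the
  corresponding levels. It is used on \<open>[t, \<infinity>)\<close>, where right-continuity of \<open>F\<close> suffices, and on \<open>[0, \<infinity>)\<close>.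
\<close>

lemma hderiv_mu_has_derivative:
  assumes "0 \<le> t" "T \<subseteq> {0..}" "t \<in> T" and X: "\<mu> ` T \<subseteq> X" "(cdf F \<longlongrightarrow> cdf F (\<mu> t)) (at (\<mu> t) within X)"
  shows "(hderiv \<mu> has_real_derivative - (lam * (1 - cdf F (\<mu> t)) * hderiv \<mu> t)) (at t within T)"
proof -
  have "((\<lambda>x. - phi F x) has_real_derivative 1 - cdf F (\<mu> t)) (at (\<mu> t) within X)"
  proof (rule sandwich_has_derivative[of UNIV "\<lambda>x. 1 - cdf F x"])
    show "((\<lambda>x. 1 - cdf F x) \<longlongrightarrow> 1 - cdf F (\<mu> t)) (at (\<mu> t) within X)"
      by (intro tendsto_diff tendsto_const X)
    show "(1 - cdf F y) * (y - x) \<le> - phi F y - - phi F x" if "x \<le> y" for x y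
      using phi_sandwich(1)[OF offers_integrable that] by simp
    show "- phi F y - - phi F x \<le> (1 - cdf F x) * (y - x)" if "x \<le> y" for x y
      using phi_sandwich(2)[OF offers_integrable that] by simp
  qed (use assms in auto)
  from DERIV_minus[OF this]
  have "(phi F has_real_derivative - (1 - cdf F (\<mu> t))) (at (\<mu> t) within X)" by simp
  then have 1: "(phi F has_real_derivative - (1 - cdf F (\<mu> t))) (at (\<mu> t) within \<mu> ` T)"
    by (rule DERIV_subset) (rule X)
  have 2: "(\<mu> has_real_derivative lam * phi F (\<mu> t)) (at t within T)"
    by (rule DERIV_subset[OF mu_has_derivative[OF assms(1)] assms(2)])
  have "((\<lambda>s. lam * (phi F \<circ> \<mu>) s) has_real_derivative lam * (- (1 - cdf F (\<mu> t)) * (lam * phi F (\<mu> t)))) (at t within T)"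
    by (rule DERIV_cmult[OF DERIV_image_chain[OF 1 2]])
  then have "(hderiv \<mu> has_real_derivative lam * (- (1 - cdf F (\<mu> t)) * (lam * phi F (\<mu> t)))) (at t within T)"
    by (rule has_field_derivative_transform_within[where d = 1]) (use assms in \<open>auto simp: hderiv_mu\<close>)
  then show ?thesis using assms(1) by (simp add: hderiv_mu algebra_simps)
qed

text \<open>
  Wherever the second derivative exists it equals the right derivative of \<open>\<mu>'\<close>, and that exists
  everywhere.
\<close>

lemma h_fun_mu:
  assumes "t \<in> h_dom \<mu>"
  shows "h_fun \<mu> t = lam * (1 - cdf F (\<mu> t))"
proof -
  have t: "0 \<le> t" "hderiv \<mu> differentiable (at t within {0..})" using assms by (auto simp: h_dom_def)
  have 1: "(hderiv \<mu> has_real_derivative hderiv (hderiv \<mu>) t) (at t within {t..})"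
    by (rule DERIV_subset[OF hderiv_works[OF t]]) (use t in auto)
  have "(cdf F \<longlongrightarrow> cdf F (\<mu> t)) (at (\<mu> t) within {\<mu> t..})"
    using cdf_is_right_cont[of "\<mu> t"] by (simp add: continuous_within at_within_Ici_at_right)
  then have 2: "(hderiv \<mu> has_real_derivative - (lam * (1 - cdf F (\<mu> t)) * hderiv \<mu> t)) (at t within {t..})"
    using t mu_le by (intro hderiv_mu_has_derivative[of t _ "{\<mu> t..}"]) auto
  have "hderiv (hderiv \<mu>) t = - (lam * (1 - cdf F (\<mu> t)) * hderiv \<mu> t)"
    by (rule has_field_derivative_unique[OF 1 2]) (simp add: at_within_Ici_at_right)
  then show ?thesis using hderiv_mu_pos[OF t(1)] by (simp add: h_fun_def)
qed

lemma h_dom_mu: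
  assumes "0 \<le> t" "isCont (cdf F) (\<mu> t)"
  shows "t \<in> h_dom \<mu>"
  using hderiv_mu_has_derivative[of t "{0..}" UNIV] assms
  by (auto simp: h_dom_def real_differentiable_def isCont_def)

lemma h_fun_mu_pos: "t \<in> h_dom \<mu> \<Longrightarrow> 0 < h_fun \<mu> t"
  using h_fun_mu[of t] cdf_less_1[of "\<mu> t"] mu_levels[of t] lam_pos by (simp add: h_dom_def levels_def)

text \<open>
  The second derivative exists unless \<open>\<mu> t\<close> is an atom of \<open>F\<close>; there are countably many atoms and \<open>\<mu>\<close> is
  injective.
\<close>

lemma h_mu_AE: "AE t in lborel. 0 \<le> t \<longrightarrow> t \<in> h_dom \<mu> \<and> 0 < h_fun \<mu> t"
proof -
  define Z where "Z = {t. 0 \<le> t \<and> \<not> isCont (cdf F) (\<mu> t)}"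
  have "inj_on \<mu> Z"
    by (rule linorder_inj_onI) (use mu_less in \<open>auto simp: Z_def\<close>, force)
  moreover have "\<mu> ` Z \<subseteq> {x. measure F {x} > 0}"
    by (auto simp: Z_def isCont_cdf zero_less_measure_iff)
  then have "countable (\<mu> ` Z)" using countable_atoms by (rule countable_subset)
  ultimately have "countable Z" by (simp add: countable_image_inj_eq)
  then have "Z \<in> null_sets lborel" by (rule countable_imp_null_set_lborel)
  then show ?thesis
    by (rule AE_I') (auto simp: Z_def h_dom_mu intro: h_fun_mu_pos)
qed

lemma h_mu_antimono: "antimono_on (h_dom \<mu>) (h_fun \<mu>)"
proof (rule monotone_onI)
  fix s t assume *: "s \<in> h_dom \<mu>" "t \<in> h_dom \<mu>" "s \<le> t"
  then have "cdf F (\<mu> s) \<le> cdf F (\<mu> t)" by (intro cdf_nondecreasing mu_le) (auto simp: h_dom_def)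
  then show "h_fun \<mu> t \<le> h_fun \<mu> s" using * lam_pos by (simp add: h_fun_mu)
qed

lemma h_mu_at_0: "h_at_0_le \<mu> lam"
  unfolding h_at_0_le_def
proof (intro exI conjI)
  let ?S = "h_dom \<mu> \<inter> {0<..}"
  have "(\<mu> \<longlongrightarrow> \<mu> 0) (at 0 within {0..})" using mu_continuous by (simp add: continuous_on_def)
  then have "(\<mu> \<longlongrightarrow> m) (at 0 within ?S)"
    unfolding mu_0 by (rule tendsto_within_subset) auto
  then have "filterlim \<mu> (at_right m) (at 0 within ?S)"
    unfolding filterlim_at
  proof (intro conjI)
    have gt: "m < \<mu> t" if "0 < t" for t using mu_less[of 0 t] mu_0 that by simp
    then show "eventually (\<lambda>t. \<mu> t \<in> {m<..} \<and> \<mu> t \<noteq> m) (at 0 within ?S)"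
      unfolding eventually_at_filter by (intro always_eventually allI impI) (auto dest: gt)
  qed
  moreover have "(cdf F \<longlongrightarrow> cdf F m) (at_right m)"
    using cdf_is_right_cont[of m] by (simp add: continuous_within)
  ultimately have "((\<lambda>t. cdf F (\<mu> t)) \<longlongrightarrow> cdf F m) (at 0 within ?S)"
    by (rule filterlim_compose[rotated])
  then have lim: "((\<lambda>t. lam * (1 - cdf F (\<mu> t))) \<longlongrightarrow> lam * (1 - cdf F m)) (at 0 within ?S)"
    by (intro tendsto_intros)
  show "(h_fun \<mu> \<longlongrightarrow> lam * (1 - cdf F m)) (at 0 within ?S)"
    by (rule Lim_transform_eventually[OF lim])
      (auto simp: eventually_at_filter h_fun_mu intro!: always_eventually)
  show "lam * (1 - cdf F m) \<le> lam"
    using lam_pos cdf_nonneg[of m] by (simp add: mult_le_cancel_left1)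
qed

end

section \<open>Reconstruction of the offer distribution\<close>

text \<open>
  The converse part, for a function \<open>\<mu>\<close> with the analytic properties of an optimal policy. The assumption
  \<open>vanish\<close> reflects that \<open>\<mu>' = \<lambda> \<phi>(\<mu>)\<close> and that \<open>\<phi>\<close>, a convergent tail integral, tends to \<open>0\<close> at the upper end
  of the offers.
\<close>

locale policy =
  fixes \<mu> :: "real \<Rightarrow> real" and lam :: real
  assumes C1: "C1_halfline \<mu>"
    and ac: "abs_continuous_on {0..} (hderiv \<mu>)"
    and pos: "\<And>t. 0 \<le> t \<Longrightarrow> 0 < hderiv \<mu> t"
    and concave: "strictly_concave_on {0..} \<mu>"
    and anti: "antimono_on (h_dom \<mu>) (h_fun \<mu>)"
    and vanish: "(hderiv \<mu> \<longlongrightarrow> 0) at_top"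
    and h0: "h_at_0_le \<mu> lam"
begin

abbreviation "f \<equiv> hderiv \<mu>"

lemma mu_has_derivative: "0 \<le> t \<Longrightarrow> (\<mu> has_real_derivative f t) (at t within {0..})"
  using C1 by (intro hderiv_works) (auto simp: C1_halfline_def differentiable_on_def)

text \<open>
  A concave function lies below its tangents. The point of tangency may be the endpoint \<open>0\<close>, so the
  derivative is taken along the segment from \<open>c\<close> to \<open>x\<close>, which stays in the half-line.
\<close>

lemma tangent:
  assumes "0 \<le> c" "0 \<le> x"
  shows "\<mu> x - \<mu> c \<le> f c * (x - c)"
proof -
  define l where "l u = c + u * (x - c)" for u
  have l0: "l 0 = c" by (simp add: l_def)
  have lS: "0 \<le> l u" if "0 \<le> u" "u \<le> 1" for u
  proof -
    have "l u = (1 - u) * c + u * x" by (simp add: l_def algebra_simps)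
    then show ?thesis using that assms by simp
  qed
  have "(l has_real_derivative (x - c)) (at 0 within {0..1})"
    unfolding l_def by (auto intro!: derivative_eq_intros)
  moreover have "(\<mu> has_real_derivative f c) (at (l 0) within l ` {0..1})"
    unfolding l0 using lS by (intro DERIV_subset[OF mu_has_derivative[OF assms(1)]]) auto
  ultimately have "((\<mu> \<circ> l) has_real_derivative f c * (x - c)) (at 0 within {0..1})"
    by (rule DERIV_image_chain[rotated])
  then have "((\<lambda>u. (\<mu> (l u) - \<mu> c) / u) \<longlongrightarrow> f c * (x - c)) (at_right 0)"
    unfolding has_field_derivative_iff by (simp add: l0 at_within_Icc_at_right)
  moreover have "eventually (\<lambda>u. \<mu> x - \<mu> c \<le> (\<mu> (l u) - \<mu> c) / u) (at_right 0)"
  proof -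
    have "eventually (\<lambda>u. u \<in> {0<..<1}) (at_right (0::real))" by (rule eventually_at_right_real) simp
    then show ?thesis
    proof eventually_elim
      case (elim u)
      show ?case
      proof (cases "x = c")
        case True
        then show ?thesis by (simp add: l_def)
      next
        case False
        have "(1 - u) * \<mu> c + u * \<mu> x < \<mu> ((1 - u) * c + u * x)"
          using concave elim assms False unfolding strictly_concave_on_def by auto
        also have "(1 - u) * c + u * x = l u" by (simp add: l_def algebra_simps)
        finally show ?thesis using elim by (simp add: field_simps)
      qed
    qed
  qed
  ultimately show ?thesis by (intro tendsto_lowerbound) auto
qed

lemma mu_sandwich:
  assumes "0 \<le> s" "s \<le> t"
  shows "f t * (t - s) \<le> \<mu> t - \<mu> s" "\<mu> t - \<mu> s \<le> f s * (t - s)"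
  using tangent[of t s] tangent[of s t] assms by (auto simp: algebra_simps)

lemma f_antimono:
  assumes "0 \<le> s" "s \<le> t"
  shows "f t \<le> f s"
proof (cases "s = t")
  case False
  have "f t * (t - s) \<le> f s * (t - s)" using mu_sandwich[OF assms] by simp
  then show ?thesis using assms False by simp
qed simp

lemma mu_less:
  assumes "0 \<le> s" "s < t"
  shows "\<mu> s < \<mu> t"
proof -
  have "0 < f t * (t - s)" using pos[of t] assms by simp
  then show ?thesis using mu_sandwich(1)[of s t] assms by simp
qed

lemma mu_le: "0 \<le> s \<Longrightarrow> s \<le> t \<Longrightarrow> \<mu> s \<le> \<mu> t"
  using mu_less[of s t] by (cases "s = t") auto

lemma mu_less_iff: "0 \<le> s \<Longrightarrow> 0 \<le> t \<Longrightarrow> \<mu> s < \<mu> t \<longleftrightarrow> s < t"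
  using mu_less[of s t] mu_le[of t s] by (cases "s < t") auto

text \<open>
  \<open>-\<mu>'\<close> and \<open>\<mu>\<close>, frozen at negative times so that they are increasing and absolutely continuous on the whole
  line. The ratio of their derivatives at \<open>t > 0\<close> is \<open>h(t)\<close>.
\<close>

definition neg_slope where "neg_slope t = - f (max 0 t)"
definition level where "level t = \<mu> (max 0 t)"

lemma neg_slope_ac: "ac_increasing neg_slope"
  unfolding ac_increasing_def
proof
  show "mono neg_slope" by (intro monoI) (auto simp: neg_slope_def intro!: f_antimono)
  have "abs_continuous_on UNIV (\<lambda>t. f (max 0 t))" by (rule abs_continuous_on_extend[OF ac])
  moreover have "\<bar>- f x - - f y\<bar> = \<bar>f x - f y\<bar>" for x y by simp
  ultimately show "abs_continuous_on UNIV neg_slope" unfolding abs_continuous_on_def neg_slope_def by presburger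
qed

lemma level_ac: "ac_increasing level"
  unfolding ac_increasing_def
proof
  show m: "mono level" by (intro monoI) (auto simp: level_def intro!: mu_le)
  show "abs_continuous_on UNIV level"
  proof (rule lipschitz_abs_continuous_on)
    fix x y :: real assume "x \<le> y"
    have "level y - level x \<le> f (max 0 x) * (max 0 y - max 0 x)"
      unfolding level_def using \<open>x \<le> y\<close> by (intro mu_sandwich(2)) auto
    also have "\<dots> \<le> f 0 * (y - x)"
      using \<open>x \<le> y\<close> pos[of 0] by (intro mult_mono f_antimono) auto
    finally show "\<bar>level y - level x\<bar> \<le> f 0 * (y - x)"
      using monoD[OF m \<open>x \<le> y\<close>] by simp
  qed
qed

lemma at_within_atLeast_pos: "0 < t \<Longrightarrow> at t within {0..} = at (t::real)"
  by (rule at_within_interior) simp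

lemma level_deriv:
  assumes "0 < t"
  shows "(level has_real_derivative f t) (at t)"
proof -
  have "(\<mu> has_real_derivative f t) (at t)"
    using mu_has_derivative[of t] assms at_within_atLeast_pos[OF assms] by simp
  then show ?thesis
    by (rule has_field_derivative_transform_within_open[of _ _ _ "{0<..}"]) (use assms in \<open>auto simp: level_def\<close>)
qed

lemma neg_slope_deriv:
  assumes "0 < t" "t \<in> h_dom \<mu>"
  shows "(neg_slope has_real_derivative h_fun \<mu> t * f t) (at t)"
proof -
  have "(f has_real_derivative hderiv f t) (at t)"
    using hderiv_works[of t f] assms at_within_atLeast_pos[OF assms(1)] by (simp add: h_dom_def)
  from DERIV_minus[OF this] have "(neg_slope has_real_derivative - hderiv f t) (at t)"
    by (rule has_field_derivative_transform_within_open[of _ _ _ "{0<..}"]) (use assms in \<open>auto simp: neg_slope_def\<close>)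
  then show ?thesis using pos[of t] assms by (simp add: h_fun_def)
qed

lemma h_dom_AE: "AE t in lborel. 0 < t \<longrightarrow> t \<in> h_dom \<mu>"
  using ac_increasing_AE_differentiable[OF neg_slope_ac]
proof eventually_elim
  case (elim t)
  show ?case
  proof
    assume t: "0 < t"
    obtain D where "(neg_slope has_real_derivative D) (at t)" using elim real_differentiable_def by blast
    from DERIV_minus[OF this] have "(f has_real_derivative - D) (at t)"
      by (rule has_field_derivative_transform_within_open[of _ _ _ "{0<..}"]) (use t in \<open>auto simp: neg_slope_def\<close>)
    then show "t \<in> h_dom \<mu>"
      using t at_within_atLeast_pos[OF t] by (auto simp: h_dom_def real_differentiable_def)
  qed
qed

lemma h_dom_dense:
  assumes "0 \<le> a" "a < b"
  obtains d where "d \<in> h_dom \<mu>" "a < d" "d < b"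
proof -
  have "\<exists>d. d \<in> h_dom \<mu> \<and> a < d \<and> d < b"
  proof (rule ccontr)
    assume *: "\<nexists>d. d \<in> h_dom \<mu> \<and> a < d \<and> d < b"
    have "AE t in lborel. t \<notin> {a<..<b}"
      using h_dom_AE by eventually_elim (use * assms in auto)
    then have "{a<..<b} \<in> null_sets lborel" by (subst AE_iff_null_sets) auto
    then show False using assms by (simp add: null_sets_def)
  qed
  then show ?thesis using that by blast
qed

lemma h_anti: "s \<in> h_dom \<mu> \<Longrightarrow> t \<in> h_dom \<mu> \<Longrightarrow> s \<le> t \<Longrightarrow> h_fun \<mu> t \<le> h_fun \<mu> s"
  using anti by (auto simp: monotone_on_def)

lemma h_nonneg:
  assumes "0 < t" "t \<in> h_dom \<mu>"
  shows "0 \<le> h_fun \<mu> t"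
proof -
  have "mono_on UNIV neg_slope" using neg_slope_ac by (simp add: ac_increasing_def)
  then have "0 \<le> h_fun \<mu> t * f t"
    by (rule mono_on_imp_deriv_nonneg[OF _ neg_slope_deriv[OF assms]]) simp
  then show ?thesis using pos[of t] assms(1) by (simp add: zero_le_mult_iff)
qed

text \<open>
  The limit of \<open>h\<close> at \<open>0\<close> bounds the antitone \<open>h\<close> because the domain of \<open>h\<close> accumulates at \<open>0\<close>; on a domain
  that did not, the limit would say nothing.
\<close>

lemma h_le_lam:
  assumes "0 < d" "d \<in> h_dom \<mu>"
  shows "h_fun \<mu> d \<le> lam"
proof -
  let ?S = "h_dom \<mu> \<inter> {0<..}"
  obtain L where L: "(h_fun \<mu> \<longlongrightarrow> L) (at 0 within ?S)" "L \<le> lam"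
    using h0 by (auto simp: h_at_0_le_def)
  have "0 islimpt ?S"
    unfolding islimpt_approachable
  proof (intro allI impI)
    fix e :: real assume "0 < e"
    then obtain x where "x \<in> h_dom \<mu>" "0 < x" "x < e" using h_dom_dense[of 0 e] by blast
    then show "\<exists>x'\<in>?S. x' \<noteq> 0 \<and> dist x' 0 < e" by (intro bexI[of _ x]) auto
  qed
  then have nt: "at 0 within ?S \<noteq> bot" by (simp add: trivial_limit_within)
  have "eventually (\<lambda>t. h_fun \<mu> d \<le> h_fun \<mu> t) (at 0 within ?S)"
    unfolding eventually_at
  proof (intro exI[of _ d] conjI ballI impI assms(1))
    fix t assume "t \<in> ?S" "t \<noteq> 0 \<and> dist t 0 < d"
    then show "h_fun \<mu> d \<le> h_fun \<mu> t" using assms(2) by (intro h_anti) auto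
  qed
  then have "h_fun \<mu> d \<le> L" by (rule tendsto_lowerbound[OF L(1) _ nt])
  then show ?thesis using L(2) by simp
qed

text \<open>
  The right-continuous version of \<open>h\<close> as a function of the level: at \<open>\<mu> t\<close> it is the supremum of the values of
  \<open>h\<close> after \<open>t\<close>. For \<open>x \<ge> \<mu> 0\<close> it becomes the arrival rate of offers exceeding \<open>x\<close>. Inserting \<open>0\<close> makes it
  vanish beyond the range of \<open>\<mu>\<close>.
\<close>

definition exceed_rate where "exceed_rate x = Sup (insert 0 {h_fun \<mu> d | d. d \<in> h_dom \<mu> \<and> 0 < d \<and> x < \<mu> d})"

lemma lam_nonneg: "0 \<le> lam"
proof -
  obtain d where d: "d \<in> h_dom \<mu>" "0 < d" using h_dom_dense[of 0 1] by auto
  then show ?thesis using h_nonneg[OF d(2,1)] h_le_lam[OF d(2,1)] by simp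
qed

lemma exceed_rate_bdd: "bdd_above (insert 0 {h_fun \<mu> d | d. d \<in> h_dom \<mu> \<and> 0 < d \<and> x < \<mu> d})"
  using h_le_lam lam_nonneg by (intro bdd_aboveI[of _ lam]) auto

lemma exceed_rate_nonneg: "0 \<le> exceed_rate x"
  unfolding exceed_rate_def using exceed_rate_bdd by (intro cSup_upper) auto

lemma exceed_rate_upper: "d \<in> h_dom \<mu> \<Longrightarrow> 0 < d \<Longrightarrow> x < \<mu> d \<Longrightarrow> h_fun \<mu> d \<le> exceed_rate x"
  unfolding exceed_rate_def using exceed_rate_bdd[of x] by (intro cSup_upper) auto

lemma exceed_rate_least: "0 \<le> c \<Longrightarrow> (\<And>d. d \<in> h_dom \<mu> \<Longrightarrow> 0 < d \<Longrightarrow> x < \<mu> d \<Longrightarrow> h_fun \<mu> d \<le> c) \<Longrightarrow> exceed_rate x \<le> c"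
  unfolding exceed_rate_def by (intro cSup_least) auto

lemma exceed_rate_le_lam: "exceed_rate x \<le> lam"
  by (intro exceed_rate_least lam_nonneg h_le_lam)

lemma exceed_rate_antimono: "x \<le> y \<Longrightarrow> exceed_rate y \<le> exceed_rate x"
  by (intro exceed_rate_least exceed_rate_nonneg exceed_rate_upper) auto

lemma exceed_rate_gt:
  assumes "c < exceed_rate x" "0 \<le> c"
  obtains d where "d \<in> h_dom \<mu>" "0 < d" "x < \<mu> d" "c < h_fun \<mu> d"
  using assms unfolding exceed_rate_def by (subst (asm) less_cSup_iff) (use exceed_rate_bdd in auto)

text \<open>
  Between times \<open>a\<close> and \<open>b\<close> the ratio \<open>h\<close> of the derivatives of \<open>-\<mu>'\<close> and \<open>\<mu>\<close> is almost everywhere at most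
  \<open>exceed_rate (\<mu> a)\<close>; a constant \<open>c\<close> slightly above makes the inequality strict.
\<close>

lemma exceed_rate_upper_increment:
  assumes ab: "0 \<le> a" "a \<le> b"
  shows "f a - f b \<le> exceed_rate (\<mu> a) * (\<mu> b - \<mu> a)"
proof (cases "a = b")
  case False
  then have "a < b" using ab by simp
  then have d: "0 < \<mu> b - \<mu> a" using mu_less[of a b] ab by simp
  have "(f a - f b) / (\<mu> b - \<mu> a) \<le> exceed_rate (\<mu> a)"
  proof (rule dense_ge)
    fix c assume c: "exceed_rate (\<mu> a) < c"
    have "neg_slope b - neg_slope a \<le> c * (level b - level a)"
    proof (rule ac_increasing_compare[OF neg_slope_ac level_ac ab(2)])
      show "0 \<le> c" using c exceed_rate_nonneg[of "\<mu> a"] by simp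
      show "AE x in lborel. a < x \<and> x < b \<longrightarrow> (\<exists>D1 D2. (neg_slope has_real_derivative D1) (at x) \<and>
           (level has_real_derivative D2) (at x) \<and> D1 < c * D2)"
        using h_dom_AE
      proof eventually_elim
        case (elim x)
        show ?case
        proof (intro impI exI conjI)
          assume "a < x \<and> x < b"
          then have x: "0 < x" "a < x" "x \<in> h_dom \<mu>" using elim ab by auto
          show "(neg_slope has_real_derivative h_fun \<mu> x * f x) (at x)" by (rule neg_slope_deriv[OF x(1,3)])
          show "(level has_real_derivative f x) (at x)" by (rule level_deriv[OF x(1)])
          have "h_fun \<mu> x < c" using exceed_rate_upper[OF x(3,1) mu_less[OF ab(1) x(2)]] c by simp
          then show "h_fun \<mu> x * f x < c * f x" using pos[of x] x by simp
        qed
      qed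
    qed
    then show "(f a - f b) / (\<mu> b - \<mu> a) \<le> c"
      using d ab by (simp add: neg_slope_def level_def pos_divide_le_eq)
  qed
  then show ?thesis using d by (simp add: pos_divide_le_eq)
qed simp

text \<open>
  The same comparison with the roles exchanged: before time \<open>b\<close>, the antitone \<open>h\<close> is at least as large as all of its
  values after \<open>b\<close>.
\<close>

lemma exceed_rate_lower_increment:
  assumes ab: "0 \<le> a" "a \<le> b"
  shows "exceed_rate (\<mu> b) * (\<mu> b - \<mu> a) \<le> f a - f b"
proof (cases "a = b \<or> exceed_rate (\<mu> b) = 0")
  case True
  then show ?thesis using f_antimono[OF ab] by auto
next
  case False
  then have "a < b" using ab by simp
  then have d: "0 < \<mu> b - \<mu> a" using mu_less[of a b] ab by simp
  have "0 < exceed_rate (\<mu> b)" using False exceed_rate_nonneg[of "\<mu> b"] by simp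
  then have "exceed_rate (\<mu> b) \<le> (f a - f b) / (\<mu> b - \<mu> a)"
  proof (rule dense_le_bounded)
    fix c assume c: "0 < c" "c < exceed_rate (\<mu> b)"
    obtain e where e: "e \<in> h_dom \<mu>" "0 < e" "\<mu> b < \<mu> e" "c < h_fun \<mu> e"
      using exceed_rate_gt[OF c(2)] c(1) by auto
    have be: "b < e" using e ab mu_less_iff[of b e] by simp
    have "level b - level a \<le> 1 / c * (neg_slope b - neg_slope a)"
    proof (rule ac_increasing_compare[OF level_ac neg_slope_ac ab(2)])
      show "0 \<le> 1 / c" using c by simp
      show "AE x in lborel. a < x \<and> x < b \<longrightarrow> (\<exists>D1 D2. (level has_real_derivative D1) (at x) \<and>
           (neg_slope has_real_derivative D2) (at x) \<and> D1 < 1 / c * D2)"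
        using h_dom_AE
      proof eventually_elim
        case (elim x)
        show ?case
        proof (intro impI exI conjI)
          assume "a < x \<and> x < b"
          then have x: "0 < x" "x < b" "x \<in> h_dom \<mu>" using elim ab by auto
          show "(neg_slope has_real_derivative h_fun \<mu> x * f x) (at x)" by (rule neg_slope_deriv[OF x(1,3)])
          show "(level has_real_derivative f x) (at x)" by (rule level_deriv[OF x(1)])
          have "c < h_fun \<mu> x" using h_anti[OF x(3) e(1)] e(4) x be by simp
          then have "c * f x < h_fun \<mu> x * f x" using pos[of x] x by simp
          then show "f x < 1 / c * (h_fun \<mu> x * f x)" using c by (simp add: field_simps)
        qed
      qed
    qed
    then show "c \<le> (f a - f b) / (\<mu> b - \<mu> a)"
      using d ab c by (simp add: neg_slope_def level_def field_simps)
  qed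
  then show ?thesis using d by (simp add: pos_le_divide_eq)
qed

text \<open>
  If the rate vanished at some time, \<open>\<mu>'\<close> would be constant from then on, and positive, so
  it could not tend to \<open>0\<close>.
\<close>

lemma exceed_rate_pos:
  assumes "0 \<le> t"
  shows "0 < exceed_rate (\<mu> t)"
proof (rule ccontr)
  assume "\<not> 0 < exceed_rate (\<mu> t)"
  then have z: "exceed_rate (\<mu> t) = 0" using exceed_rate_nonneg[of "\<mu> t"] by simp
  have "eventually (\<lambda>b. f b < f t) at_top" using vanish pos[OF assms] by (rule order_tendstoD)
  then have "eventually (\<lambda>b. f b < f t \<and> t \<le> b) at_top" using eventually_ge_at_top by (rule eventually_conj)
  then obtain b where "f b < f t" "t \<le> b" 
    using eventually_happens'[OF trivial_limit_at_top_linorder] by blast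
  then show False using exceed_rate_upper_increment[OF assms, of b] z by simp
qed

lemma lam_pos: "0 < lam"
  using exceed_rate_pos[of 0] exceed_rate_le_lam[of "\<mu> 0"] by simp

lemma mu_surj:
  assumes "\<mu> a \<le> x" "x \<le> \<mu> b" "0 \<le> a" "a \<le> b"
  obtains t where "a \<le> t" "t \<le> b" "\<mu> t = x"
proof -
  have "continuous_on {0..} \<mu>" by (rule DERIV_continuous_on) (rule mu_has_derivative, simp)
  then have "continuous_on {a..b} \<mu>" by (rule continuous_on_subset) (use assms in auto)
  then show ?thesis using IVT'[of \<mu> a x b] assms that by blast
qed

text \<open>
  No offer lies below \<open>\<mu> 0\<close>; if \<open>exceed_rate (\<mu> 0) < lam\<close>, the offers that are accepted at no positive remaining
  time form an atom at \<open>\<mu> 0\<close>.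
\<close>

definition offer_cdf where "offer_cdf x = (if x < \<mu> 0 then 0 else 1 - exceed_rate x / lam)"

lemma offer_cdf_mono: "x \<le> y \<Longrightarrow> offer_cdf x \<le> offer_cdf y"
  using exceed_rate_antimono[of x y] exceed_rate_le_lam[of y] lam_pos by (auto simp: offer_cdf_def divide_right_mono)

lemma offer_cdf_right_cont: "continuous (at_right a) offer_cdf"
proof (cases "a < \<mu> 0")
  case True
  have "eventually (\<lambda>x. x \<in> {a<..<\<mu> 0}) (at_right a)" by (rule eventually_at_right_real[OF True])
  then have "eventually (\<lambda>x. offer_cdf a = offer_cdf x) (at_right a)"
    by eventually_elim (use True in \<open>simp add: offer_cdf_def\<close>)
  then show ?thesis unfolding continuous_within by (rule Lim_transform_eventually[OF tendsto_const])
next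
  case False
  have "(exceed_rate \<longlongrightarrow> exceed_rate a) (at_right a)"
  proof (rule order_tendstoI)
    fix c assume c: "c < exceed_rate a"
    show "eventually (\<lambda>x. c < exceed_rate x) (at_right a)"
    proof (cases "c < 0")
      case True
      then show ?thesis using exceed_rate_nonneg by (intro always_eventually) (auto intro: less_le_trans)
    next
      case False
      then obtain d where d: "d \<in> h_dom \<mu>" "0 < d" "a < \<mu> d" "c < h_fun \<mu> d"
        using exceed_rate_gt[OF c] by auto
      have "eventually (\<lambda>x. x \<in> {a<..<\<mu> d}) (at_right a)" by (rule eventually_at_right_real[OF d(3)])
      then show ?thesis
        by eventually_elim (use exceed_rate_upper[OF d(1,2)] d(4) in \<open>auto intro: less_le_trans\<close>)
    qed
  next
    fix c assume c: "exceed_rate a < c"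
    have "eventually (\<lambda>x. a < x) (at_right a)" by (rule eventually_at_right_less)
    then show "eventually (\<lambda>x. exceed_rate x < c) (at_right a)"
      by eventually_elim (use c exceed_rate_antimono in \<open>auto intro: le_less_trans less_imp_le\<close>)
  qed
  then have lim: "((\<lambda>x. 1 - exceed_rate x / lam) \<longlongrightarrow> offer_cdf a) (at_right a)"
    unfolding offer_cdf_def using False lam_pos by (auto intro!: tendsto_intros)
  have "eventually (\<lambda>x. a < x) (at_right a)" by (rule eventually_at_right_less)
  then have "eventually (\<lambda>x. 1 - exceed_rate x / lam = offer_cdf x) (at_right a)"
    by eventually_elim (use False in \<open>simp add: offer_cdf_def\<close>)
  then show ?thesis unfolding continuous_within by (rule Lim_transform_eventually[OF lim])
qed

lemma offer_cdf_at_bot: "(offer_cdf \<longlongrightarrow> 0) at_bot"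
proof -
  have "eventually (\<lambda>x. x < \<mu> 0) at_bot" by (rule eventually_gt_at_bot)
  then have "eventually (\<lambda>x. 0 = offer_cdf x) at_bot" by eventually_elim (simp add: offer_cdf_def)
  then show ?thesis by (rule Lim_transform_eventually[OF tendsto_const])
qed

text \<open>
  The lower increment bound from time \<open>0\<close> to the time at which \<open>\<mu>\<close> reaches \<open>x\<close>; the increment of \<open>-\<mu>'\<close> is
  at most \<open>\<mu>'(0)\<close>. This makes \<open>offer_cdf\<close> tend to \<open>1\<close> even when \<open>\<mu>\<close> is unbounded.
\<close>

lemma exceed_rate_bound:
  assumes "\<mu> 0 < x"
  shows "exceed_rate x \<le> f 0 / (x - \<mu> 0)"
proof (cases "exceed_rate x = 0")
  case True
  then show ?thesis using pos[of 0] assms by simp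
next
  case False
  then have "0 < exceed_rate x" using exceed_rate_nonneg[of x] by simp
  then obtain d where d: "d \<in> h_dom \<mu>" "0 < d" "x < \<mu> d" using exceed_rate_gt[of 0 x] by auto
  obtain t where t: "0 \<le> t" "\<mu> t = x" using mu_surj[of 0 x d] assms d by auto
  have "exceed_rate x * (x - \<mu> 0) \<le> f 0" using exceed_rate_lower_increment[of 0 t] pos[of t] t by simp
  then show ?thesis using assms by (simp add: pos_le_divide_eq)
qed

lemma offer_cdf_at_top: "(offer_cdf \<longlongrightarrow> 1) at_top"
proof -
  have "filterlim (\<lambda>x. x - \<mu> 0) at_top at_top"
    using filterlim_tendsto_add_at_top[OF tendsto_const[of "- \<mu> 0"] filterlim_ident] by simp
  then have 1: "((\<lambda>x. f 0 / (x - \<mu> 0)) \<longlongrightarrow> 0) at_top"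
    by (intro tendsto_divide_0[OF tendsto_const] filterlim_at_top_imp_at_infinity)
  have "(exceed_rate \<longlongrightarrow> 0) at_top"
  proof (rule tendsto_sandwich[OF _ _ tendsto_const 1])
    show "eventually (\<lambda>x. 0 \<le> exceed_rate x) at_top" by (simp add: exceed_rate_nonneg)
    show "eventually (\<lambda>x. exceed_rate x \<le> f 0 / (x - \<mu> 0)) at_top"
      using eventually_gt_at_top[of "\<mu> 0"] by eventually_elim (rule exceed_rate_bound)
  qed
  then have lim: "((\<lambda>x. 1 - exceed_rate x / lam) \<longlongrightarrow> 1) at_top"
    using lam_pos by (auto intro!: tendsto_eq_intros)
  have "eventually (\<lambda>x. 1 - exceed_rate x / lam = offer_cdf x) at_top"
    using eventually_gt_at_top[of "\<mu> 0"] by eventually_elim (simp add: offer_cdf_def)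
  then show ?thesis by (rule Lim_transform_eventually[OF lim])
qed

definition offer_law where "offer_law = interval_measure offer_cdf"

sublocale real_distribution offer_law
  unfolding offer_law_def
  by (rule real_distribution_interval_measure[OF offer_cdf_mono offer_cdf_right_cont offer_cdf_at_bot offer_cdf_at_top])

lemma cdf_offer_law: "cdf offer_law = offer_cdf"
  unfolding offer_law_def by (rule cdf_interval_measure[OF offer_cdf_mono offer_cdf_right_cont offer_cdf_at_bot])

lemma tail_offer_law: "\<mu> 0 \<le> x \<Longrightarrow> 1 - cdf offer_law x = exceed_rate x / lam"
  by (simp add: cdf_offer_law offer_cdf_def)

text \<open>
  As functions of the level, \<open>\<mu>'/lam\<close> and the tail integral satisfy the same sandwich inequalities.
\<close>

lemma tail_integral_offer_law:
  assumes ab: "0 \<le> a" "a \<le> b"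
  shows "(LBINT u:{\<mu> a..<\<mu> b}. 1 - cdf offer_law u) = (f a - f b) / lam"
proof -
  \<comment> \<open>The slope \<open>\<mu>'/lam\<close> as a function of the level.\<close>
  define P where "P x = f (the_inv_into {0..} \<mu> x) / lam" for x
  have inj: "inj_on \<mu> {0..}" by (rule linorder_inj_onI) (use mu_less in force)+
  have P: "P (\<mu> s) = f s / lam" if "0 \<le> s" for s
    using the_inv_into_f_f[OF inj, of s] that by (simp add: P_def)
  have st: "\<exists>s t. 0 \<le> s \<and> s \<le> t \<and> x = \<mu> s \<and> y = \<mu> t" if xy: "\<mu> a \<le> x" "x \<le> y" "y \<le> \<mu> b" for x y
  proof -
    obtain s where s: "a \<le> s" "\<mu> s = x" using mu_surj[of a x b] xy ab by auto
    obtain t where t: "a \<le> t" "\<mu> t = y" using mu_surj[of a y b] xy ab by auto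
    have "s \<le> t" using mu_less_iff[of t s] s t xy ab by auto
    then show ?thesis using s t ab by (intro exI[of _ s] exI[of _ t]) auto
  qed
  have "(LBINT u:{\<mu> a..<\<mu> b}. 1 - cdf offer_law u) = P (\<mu> a) - P (\<mu> b)"
  proof (rule tail_integral_unique)
    show "\<mu> a \<le> \<mu> b" using mu_le ab by simp
    fix x y assume xy: "\<mu> a \<le> x" "x \<le> y" "y \<le> \<mu> b"
    obtain s t where s: "0 \<le> s" "s \<le> t" "x = \<mu> s" "y = \<mu> t" using st[OF xy] by auto
    have tl: "1 - cdf offer_law x = exceed_rate x / lam" "1 - cdf offer_law y = exceed_rate y / lam"
      using tail_offer_law xy mu_le[of 0 a] ab by auto
    have Pxy: "P x - P y = (f s - f t) / lam" using s by (simp add: P diff_divide_distrib)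
    show "(1 - cdf offer_law y) * (y - x) \<le> P x - P y"
      unfolding tl Pxy using exceed_rate_lower_increment[OF s(1,2)] lam_pos s by (simp add: divide_right_mono)
    show "P x - P y \<le> (1 - cdf offer_law x) * (y - x)"
      unfolding tl Pxy using exceed_rate_upper_increment[OF s(1,2)] lam_pos s by (simp add: divide_right_mono)
  qed
  then show ?thesis using ab by (simp add: P diff_divide_distrib)
qed

lemma offer_law_phi:
  assumes "0 \<le> t"
  shows "set_integrable lborel {\<mu> t..} (\<lambda>u. 1 - cdf offer_law u)" "phi offer_law (\<mu> t) = f t / lam"
proof -
  have y: "incseq (\<lambda>n. \<mu> (t + real n))" using assms by (intro incseq_SucI mu_le) auto
  have c: "\<mu> t \<le> \<mu> (t + real n)" for n using assms by (intro mu_le) auto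
  have top: "cdf offer_law u = 1" if u: "\<And>n. \<mu> (t + real n) \<le> u" for u
  proof -
    have "exceed_rate u \<le> 0"
    proof (rule exceed_rate_least)
      fix d assume d: "d \<in> h_dom \<mu>" "0 < d" "u < \<mu> d"
      obtain n :: nat where "d \<le> real n" using real_arch_simple by blast
      then have "\<mu> d \<le> \<mu> (t + real n)" using assms d by (intro mu_le) auto
      then show "h_fun \<mu> d \<le> 0" using u[of n] d by simp
    qed simp
    then have "exceed_rate u = 0" using exceed_rate_nonneg[of u] by simp
    moreover have "\<mu> 0 \<le> u" using u[of 0] mu_le[of 0 t] assms by simp
    ultimately show ?thesis by (simp add: cdf_offer_law offer_cdf_def)
  qed
  have "filterlim (\<lambda>n. t + real n) at_top sequentially"
    by (intro filterlim_tendsto_add_at_top[OF tendsto_const] filterlim_real_sequentially)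
  then have "(\<lambda>n. f (t + real n)) \<longlonglongrightarrow> 0" by (rule filterlim_compose[OF vanish])
  then have "(\<lambda>n. (f t - f (t + real n)) / lam) \<longlonglongrightarrow> (f t - 0) / lam"
    by (intro tendsto_divide tendsto_diff tendsto_const) (use lam_pos in auto)
  then have lim: "(\<lambda>n. LBINT u:{\<mu> t..<\<mu> (t + real n)}. 1 - cdf offer_law u) \<longlonglongrightarrow> f t / lam"
    using assms by (simp add: tail_integral_offer_law)
  show "set_integrable lborel {\<mu> t..} (\<lambda>u. 1 - cdf offer_law u)" "phi offer_law (\<mu> t) = f t / lam"
    by (rule phi_from_limit[OF y c top lim]; assumption)+
qed

lemma offer_law_integrable: "integrable offer_law (\<lambda>x. max x 0)"
  using offer_law_phi(1)[of 0] by (simp add: tail_integrable_iff)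

lemma mu_le_upper_end:
  assumes "0 \<le> t"
  shows "ereal (\<mu> t) \<le> upper_end offer_law"
proof -
  have "0 < 1 - cdf offer_law (\<mu> t)"
    using tail_offer_law[of "\<mu> t"] mu_le[of 0 t] exceed_rate_pos[OF assms] lam_pos assms by simp
  then show ?thesis unfolding upper_end_def by (intro Sup_upper) auto
qed

lemma mu_less_upper_end:
  assumes "0 \<le> t"
  shows "ereal (\<mu> t) < upper_end offer_law"
proof -
  have "ereal (\<mu> t) < ereal (\<mu> (t + 1))" using mu_less[of t "t + 1"] assms by simp
  also have "\<dots> \<le> upper_end offer_law" using assms by (intro mu_le_upper_end) simp
  finally show ?thesis .
qed

lemma mu_limit: "((\<lambda>t. ereal (\<mu> t)) \<longlongrightarrow> upper_end offer_law) at_top"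
proof (rule order_tendstoI)
  fix a assume "a < upper_end offer_law"
  then obtain x where x: "a < ereal x" "cdf offer_law x < 1" unfolding upper_end_def less_Sup_iff by auto
  have "\<exists>d\<ge>0. x < \<mu> d"
  proof (cases "x < \<mu> 0")
    case False
    then have "0 < exceed_rate x / lam" using x(2) tail_offer_law[of x] by simp
    then have "0 < exceed_rate x" using lam_pos by (simp add: zero_less_divide_iff)
    then obtain d where "0 < d" "x < \<mu> d" using exceed_rate_gt[of 0 x] by auto
    then show ?thesis by (intro exI[of _ d]) auto
  qed auto
  then obtain d where d: "0 \<le> d" "x < \<mu> d" by blast
  show "eventually (\<lambda>t. a < ereal (\<mu> t)) at_top"
    using eventually_ge_at_top[of d]
  proof eventually_elim
    case (elim t)
    then have "x < \<mu> t" using d mu_le[of d t] by simp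
    then show ?case using x(1) by (auto intro: less_trans)
  qed
next
  fix a assume a: "upper_end offer_law < a"
  show "eventually (\<lambda>t. ereal (\<mu> t) < a) at_top"
    using eventually_ge_at_top[of 0]
    by eventually_elim (rule le_less_trans[OF mu_le_upper_end a])
qed

lemma sale_problem_offer_law:
  assumes "real_distribution F0" "integrable F0 (\<lambda>x. \<bar>x\<bar>)" "mean F0 = \<mu> 0" "0 \<le> \<mu> 0"
  shows "sale_problem offer_law F0 lam"
  unfolding sale_problem_def
  using assms lam_pos offer_law_integrable mu_less_upper_end[of 0] real_distribution_axioms by simp

text \<open>
  \<open>\<Psi>(\<mu>(s)) - lam s\<close> has derivative \<open>\<mu>'(s)/\<phi>(\<mu>(s)) - lam = 0\<close> and vanishes at \<open>s = 0\<close>.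
\<close>

lemma optimal_policy_offer_law:
  assumes sp: "sale_problem offer_law F0 lam" and m: "mean F0 = \<mu> 0" and "0 \<le> t"
  shows "\<mu> t = optimal_policy offer_law F0 lam t"
proof -
  interpret S: sale offer_law F0 lam using sp by unfold_locales
  have muI: "\<mu> s \<in> S.levels" if "0 \<le> s" for s
    using mu_less_upper_end[OF that] mu_le[of 0 s] that by (simp add: S.levels_def m)
  have der: "((\<lambda>s. (Psi offer_law F0 \<circ> \<mu>) s - lam * s) has_real_derivative 0) (at s within {0..})"
    if s: "s \<in> {0..}" for s
  proof -
    have "(Psi offer_law F0 has_real_derivative 1 / phi offer_law (\<mu> s)) (at (\<mu> s) within \<mu> ` {0..})"
      by (rule DERIV_subset[OF S.Psi_has_derivative[OF muI]]) (use muI s in auto)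
    then have "((Psi offer_law F0 \<circ> \<mu>) has_real_derivative 1 / phi offer_law (\<mu> s) * f s) (at s within {0..})"
      by (rule DERIV_image_chain) (use mu_has_derivative s in auto)
    moreover have "1 / phi offer_law (\<mu> s) * f s = lam"
      using offer_law_phi(2)[of s] pos[of s] lam_pos s by simp
    ultimately have "((Psi offer_law F0 \<circ> \<mu>) has_real_derivative lam) (at s within {0..})"
      by (simp only:)
    from DERIV_diff[OF this DERIV_cmult[OF DERIV_ident, of lam]] show ?thesis by simp
  qed
  have "\<exists>c. \<forall>s\<in>{0..}. (Psi offer_law F0 \<circ> \<mu>) s - lam * s = c"
    by (rule has_field_derivative_zero_constant[OF _ der]) auto
  then obtain c where c: "\<And>s. 0 \<le> s \<Longrightarrow> Psi offer_law F0 (\<mu> s) - lam * s = c" by auto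
  have "c = 0" using c[of 0] S.Psi_m by (simp add: m)
  then have "Psi offer_law F0 (\<mu> t) = lam * t" using c[OF \<open>0 \<le> t\<close>] by simp
  then have "S.\<mu> t = \<mu> t" by (rule S.mu_eqI[OF muI[OF \<open>0 \<le> t\<close>]])
  then show ?thesis by (simp add: S.\<mu>_def)
qed

end

section \<open>The characterization of optimal policies\<close>

theorem theorem2p2:
  shows
    "(\<forall>(F :: real measure) (F0 :: real measure) (lam :: real) (\<mu> :: real \<Rightarrow> real).
        sale_problem F F0 lam \<and> \<mu> = optimal_policy F F0 lam \<longrightarrow>
          (\<forall>t\<ge>0. 0 \<le> \<mu> t) \<and>
          \<mu> 0 = mean F0 \<and>
          ((\<lambda>t. ereal (\<mu> t)) \<longlongrightarrow> upper_end F) at_top \<and>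
          C1_halfline \<mu> \<and>
          abs_continuous_on {0..} (hderiv \<mu>) \<and>
          (\<forall>t\<ge>0. 0 < hderiv \<mu> t) \<and>
          strict_mono_on {0..} \<mu> \<and>
          strictly_concave_on {0..} \<mu> \<and>
          (AE t in lborel. 0 \<le> t \<longrightarrow> t \<in> h_dom \<mu> \<and> 0 < h_fun \<mu> t) \<and>
          antimono_on (h_dom \<mu>) (h_fun \<mu>) \<and>
          h_at_0_le \<mu> lam)
     \<and>
     (\<forall>(\<mu> :: real \<Rightarrow> real) (lam :: real).
        (\<forall>t\<ge>0. 0 \<le> \<mu> t) \<and>
        C1_halfline \<mu> \<and>
        abs_continuous_on {0..} (hderiv \<mu>) \<and>
        (\<forall>t\<ge>0. 0 < hderiv \<mu> t) \<and>
        strictly_concave_on {0..} \<mu> \<and>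
        antimono_on (h_dom \<mu>) (h_fun \<mu>) \<and>
        (hderiv \<mu> \<longlongrightarrow> 0) at_top \<and>
        h_at_0_le \<mu> lam \<longrightarrow>
          (\<exists>M :: ereal. ((\<lambda>t. ereal (\<mu> t)) \<longlongrightarrow> M) at_top \<and>
            (\<exists>F :: real measure.
               real_distribution F \<and> integrable F (\<lambda>x. max x 0) \<and> upper_end F = M \<and>
               (\<forall>F0 :: real measure.
                  real_distribution F0 \<and> integrable F0 (\<lambda>x. \<bar>x\<bar>) \<and> mean F0 = \<mu> 0 \<longrightarrow>
                    sale_problem F F0 lam \<and>
                    (\<forall>t\<ge>0. \<mu> t = optimal_policy F F0 lam t)))))"
proof (rule conjI; intro allI impI)
  fix F F0 :: "real measure" and lam :: real and \<mu> :: "real \<Rightarrow> real"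
  assume *: "sale_problem F F0 lam \<and> \<mu> = optimal_policy F F0 lam"
  then interpret S: sale F F0 lam by unfold_locales simp
  have eq: "\<mu> = S.\<mu>" using * by (simp add: S.\<mu>_def)
  have nonneg: "0 \<le> S.\<mu> t" if "0 \<le> t" for t
    using S.mu_levels[OF that] S.m_nonneg by (simp add: S.levels_def)
  have mono: "strict_mono_on {0..} S.\<mu>" by (rule strict_mono_onI) (simp add: S.mu_less)
  show "(\<forall>t\<ge>0. 0 \<le> \<mu> t) \<and>
          \<mu> 0 = mean F0 \<and>
          ((\<lambda>t. ereal (\<mu> t)) \<longlongrightarrow> upper_end F) at_top \<and>
          C1_halfline \<mu> \<and>
          abs_continuous_on {0..} (hderiv \<mu>) \<and>
          (\<forall>t\<ge>0. 0 < hderiv \<mu> t) \<and>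
          strict_mono_on {0..} \<mu> \<and>
          strictly_concave_on {0..} \<mu> \<and>
          (AE t in lborel. 0 \<le> t \<longrightarrow> t \<in> h_dom \<mu> \<and> 0 < h_fun \<mu> t) \<and>
          antimono_on (h_dom \<mu>) (h_fun \<mu>) \<and>
          h_at_0_le \<mu> lam"
    unfolding eq
    by (intro conjI allI impI nonneg S.mu_0 S.mu_limit S.mu_C1 S.hderiv_mu_abs_continuous
        S.hderiv_mu_pos mono S.mu_strictly_concave S.h_mu_AE S.h_mu_antimono S.h_mu_at_0)
next
  fix \<mu> :: "real \<Rightarrow> real" and lam :: real
  assume *: "(\<forall>t\<ge>0. 0 \<le> \<mu> t) \<and>
        C1_halfline \<mu> \<and>
        abs_continuous_on {0..} (hderiv \<mu>) \<and>
        (\<forall>t\<ge>0. 0 < hderiv \<mu> t) \<and>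
        strictly_concave_on {0..} \<mu> \<and>
        antimono_on (h_dom \<mu>) (h_fun \<mu>) \<and>
        (hderiv \<mu> \<longlongrightarrow> 0) at_top \<and>
        h_at_0_le \<mu> lam"
  interpret P: policy \<mu> lam
  proof (rule policy.intro)
    show "0 < hderiv \<mu> t" if "0 \<le> t" for t using * that by simp
  qed (use * in simp_all)
  have "0 \<le> \<mu> 0" using * by simp
  then have sale: "sale_problem P.offer_law F0 lam"
    if "real_distribution F0 \<and> integrable F0 (\<lambda>x. \<bar>x\<bar>) \<and> mean F0 = \<mu> 0" for F0
    using that by (intro P.sale_problem_offer_law) simp_all
  show "\<exists>M :: ereal. ((\<lambda>t. ereal (\<mu> t)) \<longlongrightarrow> M) at_top \<and>
            (\<exists>F :: real measure.
               real_distribution F \<and> integrable F (\<lambda>x. max x 0) \<and> upper_end F = M \<and>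
               (\<forall>F0 :: real measure.
                  real_distribution F0 \<and> integrable F0 (\<lambda>x. \<bar>x\<bar>) \<and> mean F0 = \<mu> 0 \<longrightarrow>
                    sale_problem F F0 lam \<and>
                    (\<forall>t\<ge>0. \<mu> t = optimal_policy F F0 lam t)))"
  proof (intro exI[of _ "upper_end P.offer_law"] exI[of _ P.offer_law] conjI allI impI)
    show "((\<lambda>t. ereal (\<mu> t)) \<longlongrightarrow> upper_end P.offer_law) at_top" by (rule P.mu_limit)
    show "real_distribution P.offer_law" by (rule P.real_distribution_axioms)
    show "integrable P.offer_law (\<lambda>x. max x 0)" by (rule P.offer_law_integrable)
    fix F0 :: "real measure"
    assume F0: "real_distribution F0 \<and> integrable F0 (\<lambda>x. \<bar>x\<bar>) \<and> mean F0 = \<mu> 0"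
    show "sale_problem P.offer_law F0 lam" by (rule sale[OF F0])
    show "\<mu> t = optimal_policy P.offer_law F0 lam t" if "0 \<le> t" for t
      using F0 that by (intro P.optimal_policy_offer_law sale) simp_all
  qed simp
qed

end
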